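(* Let $\alpha\in\mathbb{R}$, $\alpha\neq 0,1$. Then the estimate $$\|(vw_1w_2)_x\|_{X_{-\frac12,-\frac12+4\epsilon}}\lesssim \|v\|_{X_{-\frac12,\frac12+\epsilon}}\|w_1\|_{X^\alpha_{-\frac12,\frac12+\epsilon}}\|w_2\|_{X^\alpha_{-\frac12,\frac12+\epsilon}}$$ and the estimate $$\|(v_1v_2w)_x\|_{X^\alpha_{-\frac12,-\frac12+4\epsilon}}\lesssim \|v_1\|_{X_{-\frac12,\frac12+\epsilon}}\|v_2\|_{X_{-\frac12,\frac12+\epsilon}}\|w\|_{X^\alpha_{-\frac12,\frac12+\epsilon}}$$ fail to hold whenever $\epsilon>0$.
   Context: Write $\langle\cdot\rangle:=1+|\cdot|$ and let $\tilde f(\tau,\xi)$ denote the space-time Fourier transform of $f(t,x)$. For $s,b\in\mathbb{R}$, $X^{\alpha}_{s,b}$ is the completion of the Schwartz class $\mathcal{S}(\mathbb{R}^2)$ under the norm $$\|f\|_{X^{\alpha}_{s,b}}:=\|\langle\xi\rangle^s\langle\tau-\alpha\xi^3\rangle^b\tilde f(\tau,\xi)\|_{L^2_{\tau,\xi}},$$ and $X_{s,b}:=X^1_{s,b}$. The subscript $x$ denotes $\partial_x$. An estimate $A\lesssim B$ "holds" if there is a constant $C>0$, independent of the functions involved, such that $A\le CB$ for all (Schwartz) functions; it "fails to hold" if no such constant exists. *)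

theory Defs
  imports "HOL-Analysis.Analysis"
begin

text \<open>
  Functions on space-time are functions of a pair \<open>(t, x)\<close>; their Fourier transforms are
  functions of \<open>(\<tau>, \<xi>)\<close>.
\<close>

definition partial_t :: "(real \<times> real \<Rightarrow> complex) \<Rightarrow> real \<times> real \<Rightarrow> complex" where
  "partial_t f = (\<lambda>(t, x). vector_derivative (\<lambda>t'. f (t', x)) (at t))"

definition partial_x :: "(real \<times> real \<Rightarrow> complex) \<Rightarrow> real \<times> real \<Rightarrow> complex" where
  "partial_x f = (\<lambda>(t, x). vector_derivative (\<lambda>x'. f (t, x')) (at x))"

text \<open>
  Differentiability of every \<open>\<partial>\<^sub>t\<^sup>i \<partial>\<^sub>x\<^sup>j f\<close> guarantees that all the partial
  derivatives exist and are continuous (so that they commute), that is, that \<open>f\<close> is smooth.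
\<close>

definition schwartz :: "(real \<times> real \<Rightarrow> complex) set" where
  "schwartz = {f. \<forall>i j.
      (partial_t ^^ i) ((partial_x ^^ j) f) differentiable_on UNIV \<and>
      (\<forall>k l. bounded (range (\<lambda>(t, x).
          (t ^ k * x ^ l) *\<^sub>R (partial_t ^^ i) ((partial_x ^^ j) f) (t, x))))}"

text \<open>
  The convention without \<open>2\<pi>\<close> in the exponent is the one for which solutions of
  \<open>u\<^sub>t + \<alpha> u\<^sub>x\<^sub>x\<^sub>x = 0\<close> have Fourier transform supported on \<open>\<tau> = \<alpha> \<xi>\<^sup>3\<close>. A constant factor in front
  of the integral would only change the constants in the estimates.
\<close>

definition fourier :: "(real \<times> real \<Rightarrow> complex) \<Rightarrow> real \<times> real \<Rightarrow> complex" where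
  "fourier f = (\<lambda>(\<tau>, \<xi>). LINT (t, x)|lborel. exp (- (\<i> * of_real (t * \<tau> + x * \<xi>))) * f (t, x))"

definition bracket :: "real \<Rightarrow> real" ("\<langle>_\<rangle>") where
  "\<langle>y\<rangle> = 1 + \<bar>y\<bar>"

text \<open>
  The norm of \<open>X\<^sup>\<alpha>\<^sub>s\<^sub>,\<^sub>b\<close>, used here on Schwartz functions only: for these the integrand is
  integrable, so that the integral does not take its default value.
\<close>

definition X_norm :: "real \<Rightarrow> real \<Rightarrow> real \<Rightarrow> (real \<times> real \<Rightarrow> complex) \<Rightarrow> real" where
  "X_norm \<alpha> s b f =
     sqrt (LINT (\<tau>, \<xi>)|lborel.
       (\<langle>\<xi>\<rangle> powr s * \<langle>\<tau> - \<alpha> * \<xi> ^ 3\<rangle> powr b * cmod (fourier f (\<tau>, \<xi>)))\<^sup>2)"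

end

theory Submission
  imports Defs "HOL-Probability.Characteristic_Functions" "HOL-Probability.Sinc_Integral"
begin

text \<open>
  Both estimates are instances of one trilinear estimate with two dispersion coefficients
  \<open>a \<noteq> b\<close>: one factor \<open>f\<close> and the product are measured along the curve \<open>\<tau> = a \<xi>\<^sup>3\<close>, the other two
  factors \<open>g\<close>, \<open>h\<close> along \<open>\<tau> = b \<xi>\<^sup>3\<close>. It fails because of the resonance in which \<open>f\<close> has frequency
  \<open>N\<close> and \<open>g\<close>, \<open>h\<close> have the opposite frequencies \<open>N\<close> and \<open>-N\<close>: the centres \<open>(a N\<^sup>3, N)\<close>,
  \<open>(b N\<^sup>3, N)\<close>, \<open>(-b N\<^sup>3, -N)\<close> add up to \<open>(a N\<^sup>3, N)\<close>, which lies on the first curve.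

  Let the Fourier transforms of \<open>g\<close> and \<open>h\<close> be concentrated on parallelograms of \<open>\<tau>\<close>-width \<open>1\<close> and
  \<open>\<xi>\<close>-length \<open>1/N\<close> along the tangents to the second curve at the frequencies \<open>N\<close> and \<open>-N\<close>. Both
  tangents have slope \<open>3 b N\<^sup>2\<close>. Let that of \<open>f\<close> be concentrated on a box of size \<open>1 \<times> 1/N\<^sup>2\<close>,
  short enough that its slope is irrelevant to the norm. Then the product lives on
  a parallelogram of \<open>\<xi>\<close>-length about \<open>1/N\<close> and slope \<open>3 b N\<^sup>2\<close>, whereas the curve that it is measured
  against has slope \<open>3 a N\<^sup>2\<close>. The two directions being transversal, the distance \<open>\<tau> - a \<xi>\<^sup>3\<close> is of
  size \<open>N\<close> on most of the parallelogram. With physical amplitudes \<open>1\<close>, the squared norms are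
  \<open>\<lesssim> N\<close> for \<open>f\<close>, \<open>\<lesssim> 1\<close> for \<open>g\<close> and \<open>h\<close>, and \<open>\<gtrsim> N\<^sup>2 N\<^bsup>2(-1/2+4\<epsilon>)\<^esup> = N\<^bsup>1+8\<epsilon>\<^esup>\<close> for the derivative
  of the product, so that the squared estimate loses the factor \<open>N\<^bsup>8\<epsilon>\<^esup>\<close>.

  Gaussian wave packets (\<open>packet\<close>) make this computable. Packets with a common slope are closed
  under multiplication (\<open>packet_mult\<close>), which is why \<open>f\<close> also gets the slope \<open>3 b N\<^sup>2\<close>; their Fourier
  transforms are explicit (\<open>norm_fourier_packet\<close>); and in coordinates adapted to the parallelogram
  the squared norm is a Gaussian integral of the weights (\<open>X_norm_packet_eq\<close>). It is
  bounded above by dominating the weights by polynomials (\<open>X_norm_packet_upper\<close>), and below by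
  restricting the integral to a unit box on which the distance to the curve is of size \<open>N\<close>
  (\<open>modulation_transversal\<close>, \<open>X_norm_derivative_lower\<close>).
\<close>

section \<open>Shears of the plane\<close>

lemma integrable_product_lborel:
  fixes g h :: "real \<Rightarrow> real"
  assumes g: "integrable lborel g" and h: "integrable lborel h"
  shows "integrable lborel (\<lambda>(x, y). g x * h y)"
proof -
  have [measurable]: "g \<in> borel_measurable borel" "h \<in> borel_measurable borel"
    using g h by auto
  have "integrable (lborel \<Otimes>\<^sub>M lborel) (\<lambda>(x, y). g x * h y)"
    using g h by (intro lborel_pair.Fubini_integrable) (auto simp: abs_mult)
  then show ?thesis
    by (simp add: lborel_prod)
qed

text \<open>
  In the coordinates \<open>(w, \<eta>)\<close> a parallelogram of slope \<open>c\<close>, with \<open>\<tau>\<close>-width \<open>r\<close> and \<open>\<xi>\<close>-length \<open>s\<close>,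
  becomes the unit square. Integrating in \<open>\<tau>\<close> first, the shear is only a translation.
\<close>
lemma lborel_shear_affine:
  fixes \<tau>\<^sub>0 \<xi>\<^sub>0 c r s :: real
  assumes "r \<noteq> 0" "s \<noteq> 0"
  defines "S \<equiv> \<lambda>(w, \<eta>). (\<tau>\<^sub>0 + c * (s * \<eta>) + r * w, \<xi>\<^sub>0 + s * \<eta>)"
  shows "(lborel :: (real \<times> real) measure) = density (distr lborel borel S) (\<lambda>_. ennreal \<bar>r * s\<bar>)"
proof (rule measure_eqI)
  have "continuous_on UNIV S"
    unfolding S_def case_prod_unfold by (intro continuous_intros)
  then have S [measurable]: "S \<in> borel \<rightarrow>\<^sub>M borel"
    by (rule borel_measurable_continuous_onI)
  fix A :: "(real \<times> real) set"
  assume "A \<in> sets lborel"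
  then have [measurable]: "A \<in> sets borel" by simp
  have m1 [measurable]: "(\<lambda>p. indicator A p :: ennreal) \<in> borel_measurable borel" by simp
  have m2 [measurable]: "(\<lambda>p. indicator A (S p) :: ennreal) \<in> borel_measurable borel" by measurable
  have slice: "(\<lambda>x. indicator A (x, y) :: ennreal) \<in> borel_measurable borel" for y :: real
    by measurable
  have "emeasure lborel A = (\<integral>\<^sup>+p. indicator A p \<partial>(lborel \<Otimes>\<^sub>M lborel))"
    by (simp add: lborel_prod)
  also have "\<dots> = (\<integral>\<^sup>+\<xi>. \<integral>\<^sup>+\<tau>. indicator A (\<tau>, \<xi>) \<partial>lborel \<partial>lborel)"
    by (rule lborel_pair.nn_integral_snd[symmetric]) (simp add: lborel_prod)
  also have "\<dots> = (\<integral>\<^sup>+\<xi>. ennreal \<bar>r\<bar> * (\<integral>\<^sup>+w. indicator A (\<tau>\<^sub>0 + c * (\<xi> - \<xi>\<^sub>0) + r * w, \<xi>) \<partial>lborel) \<partial>lborel)"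
    using assms(1) by (intro nn_integral_cong nn_integral_real_affine slice) auto
  also have "\<dots> = ennreal \<bar>s\<bar> * (\<integral>\<^sup>+\<eta>. ennreal \<bar>r\<bar> * (\<integral>\<^sup>+w. indicator A (S (w, \<eta>)) \<partial>lborel) \<partial>lborel)"
    using assms(2) unfolding S_def by (subst nn_integral_real_affine[where c=s and t=\<xi>\<^sub>0]) auto
  also have "\<dots> = ennreal \<bar>s\<bar> * (ennreal \<bar>r\<bar> * (\<integral>\<^sup>+\<eta>. (\<integral>\<^sup>+w. indicator A (S (w, \<eta>)) \<partial>lborel) \<partial>lborel))"
    by (subst nn_integral_cmult) auto
  also have "(\<integral>\<^sup>+\<eta>. (\<integral>\<^sup>+w. indicator A (S (w, \<eta>)) \<partial>lborel) \<partial>lborel) = (\<integral>\<^sup>+p. indicator A (S p) \<partial>(lborel \<Otimes>\<^sub>M lborel))"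
    by (rule lborel_pair.nn_integral_snd[where f = "\<lambda>p. indicator A (S p)"]) (simp add: lborel_prod)
  also have "ennreal \<bar>s\<bar> * (ennreal \<bar>r\<bar> * \<dots>) = ennreal \<bar>r * s\<bar> * (\<integral>\<^sup>+p. indicator A (S p) \<partial>lborel)"
    by (simp add: lborel_prod abs_mult ennreal_mult mult_ac)
  also have "(\<integral>\<^sup>+p. indicator A (S p) \<partial>lborel) = (\<integral>\<^sup>+z. indicator A z \<partial>distr lborel borel S)"
    by (rule nn_integral_distr[symmetric]) simp_all
  also have "ennreal \<bar>r * s\<bar> * \<dots> = emeasure (density (distr lborel borel S) (\<lambda>_. ennreal \<bar>r * s\<bar>)) A"
    by (simp add: emeasure_density nn_integral_cmult)
  finally show "emeasure lborel A = emeasure (density (distr lborel borel S) (\<lambda>_. ennreal \<bar>r * s\<bar>)) A" .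
qed simp

lemma lborel_integral_shear_affine:
  fixes f :: "real \<times> real \<Rightarrow> real" and \<tau>\<^sub>0 \<xi>\<^sub>0 c r s :: real
  assumes f: "f \<in> borel_measurable borel" and "r \<noteq> 0" "s \<noteq> 0"
  defines "S \<equiv> \<lambda>(w, \<eta>). (\<tau>\<^sub>0 + c * (s * \<eta>) + r * w, \<xi>\<^sub>0 + s * \<eta>)"
  shows "integral\<^sup>L lborel f = \<bar>r * s\<bar> * (LINT p|lborel. f (S p))"
proof -
  have "continuous_on UNIV S"
    unfolding S_def case_prod_unfold by (intro continuous_intros)
  then have S [measurable]: "S \<in> borel \<rightarrow>\<^sub>M borel"
    by (rule borel_measurable_continuous_onI)
  note [measurable] = f
  have L: "lborel = density (distr lborel borel S) (\<lambda>_. ennreal \<bar>r * s\<bar>)"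
    unfolding S_def by (rule lborel_shear_affine) fact+
  show "integral\<^sup>L lborel f = \<bar>r * s\<bar> * (LINT p|lborel. f (S p))"
    by (subst L) (simp add: integral_density integral_distr)
qed

section \<open>Schwartz functions and their Fourier transforms\<close>

lemma schwartz_partial_x:
  assumes "f \<in> schwartz"
  shows "partial_x f \<in> schwartz"
proof -
  have *: "(partial_x ^^ j) (partial_x f) = (partial_x ^^ Suc j) f" for j
    by (simp add: funpow_swap1)
  show ?thesis
    using assms unfolding schwartz_def mem_Collect_eq * by blast
qed

lemma schwartz_continuous:
  assumes "f \<in> schwartz"
  shows "continuous_on UNIV f"
proof -
  have "(partial_t ^^ 0) ((partial_x ^^ 0) f) differentiable_on UNIV"
    using assms unfolding schwartz_def mem_Collect_eq by blast
  then show ?thesis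
    by (simp add: differentiable_imp_continuous_on)
qed

lemma schwartz_has_vector_derivative_x:
  assumes "f \<in> schwartz"
  shows "((\<lambda>x. f (t, x)) has_vector_derivative partial_x f (t, x)) (at x)"
proof -
  have "(partial_t ^^ 0) ((partial_x ^^ 0) f) differentiable_on UNIV"
    using assms unfolding schwartz_def mem_Collect_eq by blast
  then have "f differentiable (at (t, x))"
    by (simp add: differentiable_on_def)
  then have "(f \<circ> (\<lambda>x. (t, x))) differentiable (at x)"
    by (intro differentiable_chain_at) (auto intro!: differentiable_Pair)
  then show ?thesis
    unfolding partial_x_def by (simp add: o_def vector_derivative_works)
qed

lemma schwartz_decay:
  assumes "f \<in> schwartz"
  obtains B where "B \<ge> 0" "\<And>t x. cmod (f (t, x)) \<le> B * (inverse (1 + t\<^sup>2) * inverse (1 + x\<^sup>2))"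
proof -
  have "\<exists>B. \<forall>t x. \<bar>t ^ k * x ^ l\<bar> * cmod (f (t, x)) \<le> B" for k l
  proof -
    have "bounded (range (\<lambda>(t, x). (t ^ k * x ^ l) *\<^sub>R (partial_t ^^ 0) ((partial_x ^^ 0) f) (t, x)))"
      using assms unfolding schwartz_def mem_Collect_eq by blast
    then show ?thesis
      by (auto simp: bounded_iff)
  qed
  then obtain B where B: "\<And>k l t x. \<bar>t ^ k * x ^ l\<bar> * cmod (f (t, x)) \<le> B k l" by metis
  have B0: "B k l \<ge> 0" for k l
    using B[where k=k and l=l and t=0 and x=0] order_trans[OF _ B[where k=k and l=l and t=0 and x=0]]
    by (metis abs_ge_zero mult_nonneg_nonneg norm_ge_zero)
  let ?B = "B 0 0 + B 2 0 + B 0 2 + B 2 2"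
  have "cmod (f (t, x)) \<le> ?B * (inverse (1 + t\<^sup>2) * inverse (1 + x\<^sup>2))" for t x
  proof -
    have "(1 + t\<^sup>2) * (1 + x\<^sup>2) * cmod (f (t, x)) \<le> ?B"
      using B[where k=0 and l=0 and t=t and x=x] B[where k=2 and l=0 and t=t and x=x]
        B[where k=0 and l=2 and t=t and x=x] B[where k=2 and l=2 and t=t and x=x]
      by (simp add: algebra_simps abs_mult)
    moreover have "1 + t\<^sup>2 > 0" "1 + x\<^sup>2 > 0"
      by (auto intro: add_pos_nonneg)
    ultimately have "cmod (f (t, x)) \<le> ?B / ((1 + t\<^sup>2) * (1 + x\<^sup>2))"
      by (subst pos_le_divide_eq) (simp_all add: mult.commute)
    then show ?thesis
      by (simp add: divide_inverse)
  qed
  moreover have "?B \<ge> 0" using B0 by simp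
  ultimately show ?thesis using that by blast
qed

lemma integrable_inverse_1_plus_square': "integrable lborel (\<lambda>x::real. inverse (1 + x\<^sup>2))"
  using integrable_inverse_1_plus_square by (simp add: set_integrable_def)

lemma schwartz_integrable:
  assumes "f \<in> schwartz"
  shows "integrable lborel f"
proof -
  obtain B where B: "B \<ge> 0" "\<And>t x. cmod (f (t, x)) \<le> B * (inverse (1 + t\<^sup>2) * inverse (1 + x\<^sup>2))"
    using schwartz_decay[OF assms] by blast
  have "integrable lborel (\<lambda>p. B * (\<lambda>(t::real, x::real). inverse (1 + t\<^sup>2) * inverse (1 + x\<^sup>2)) p)"
    by (intro integrable_mult_right integrable_product_lborel integrable_inverse_1_plus_square')
  then show ?thesis
  proof (rule Bochner_Integration.integrable_bound)
    show "f \<in> borel_measurable lborel"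
      using schwartz_continuous[OF assms] by (simp add: borel_measurable_continuous_onI)
    show "AE p in lborel. cmod (f p) \<le> norm (B * (\<lambda>(t::real, x::real). inverse (1 + t\<^sup>2) * inverse (1 + x\<^sup>2)) p)"
      using B by (intro AE_I2) (auto simp: abs_mult)
  qed
qed

lemma schwartz_integrable_x:
  assumes "f \<in> schwartz"
  shows "integrable lborel (\<lambda>x. f (t, x))"
proof -
  obtain B where B: "B \<ge> 0" "\<And>t x. cmod (f (t, x)) \<le> B * (inverse (1 + t\<^sup>2) * inverse (1 + x\<^sup>2))"
    using schwartz_decay[OF assms] by blast
  have "integrable lborel (\<lambda>x::real. B * (inverse (1 + t\<^sup>2) * inverse (1 + x\<^sup>2)))"
    by (intro integrable_mult_right integrable_inverse_1_plus_square')
  then show ?thesis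
  proof (rule Bochner_Integration.integrable_bound)
    have "continuous_on UNIV (\<lambda>x. f (t, x))"
      by (intro continuous_on_compose2[OF schwartz_continuous[OF assms]] continuous_intros) auto
    then show "(\<lambda>x. f (t, x)) \<in> borel_measurable lborel"
      by (simp add: borel_measurable_continuous_onI)
    show "AE x in lborel. cmod (f (t, x)) \<le> norm (B * (inverse (1 + t\<^sup>2) * inverse (1 + x\<^sup>2)))"
      using B by (intro AE_I2) (auto simp: abs_mult)
  qed
qed

lemma fourier_phase_integrable:
  fixes f :: "real \<times> real \<Rightarrow> complex"
  assumes "integrable lborel f"
  shows "integrable lborel (\<lambda>(t, x). exp (- (\<i> * of_real (t * \<tau> + x * \<xi>))) * f (t, x))"
proof (rule Bochner_Integration.integrable_bound[OF assms])
  have "continuous_on UNIV (\<lambda>p. exp (- (\<i> * of_real (fst p * \<tau> + snd p * \<xi>))))"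
    by (intro continuous_intros)
  then have [measurable]: "(\<lambda>p. exp (- (\<i> * of_real (fst p * \<tau> + snd p * \<xi>)))) \<in> borel_measurable borel"
    by (rule borel_measurable_continuous_onI)
  have [measurable]: "f \<in> borel_measurable borel"
    using borel_measurable_integrable[OF assms] by simp
  show "(\<lambda>(t, x). exp (- (\<i> * of_real (t * \<tau> + x * \<xi>))) * f (t, x)) \<in> borel_measurable lborel"
    unfolding case_prod_unfold prod.collapse by measurable
qed (simp add: norm_mult split_beta)

lemma fourier_iterated:
  assumes "integrable lborel f"
  shows "fourier f (\<tau>, \<xi>) = (LINT t|lborel. LINT x|lborel. exp (- (\<i> * of_real (t * \<tau> + x * \<xi>))) * f (t, x))"
  unfolding fourier_def
  using lborel_pair.integral_fst'[of "\<lambda>(t, x). exp (- (\<i> * of_real (t * \<tau> + x * \<xi>))) * f (t, x)"]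
    fourier_phase_integrable[OF assms, of \<tau> \<xi>]
  by (simp add: lborel_prod)

lemma inverse_1_plus_square_tendsto_0:
  assumes "F = at_top \<or> F = at_bot"
  shows "((\<lambda>x::real. inverse (1 + x\<^sup>2)) \<longlongrightarrow> 0) F"
proof -
  have "filterlim (\<lambda>x::real. x\<^sup>2) at_top F"
    using assms by (auto intro: filterlim_pow_at_top filterlim_ident filterlim_pow_at_bot_even)
  then have "filterlim (\<lambda>x::real. 1 + x\<^sup>2) at_top F"
    by (intro filterlim_tendsto_add_at_top[OF tendsto_const])
  then show ?thesis
    by (rule tendsto_inverse_0_at_top)
qed

lemma schwartz_x_tendsto_0:
  assumes "f \<in> schwartz" and F: "F = at_top \<or> F = at_bot"
  shows "((\<lambda>x. exp (- (\<i> * of_real (t * \<tau> + x * \<xi>))) * f (t, x)) \<longlongrightarrow> 0) F"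
proof -
  obtain B where B: "B \<ge> 0" "\<And>t x. cmod (f (t, x)) \<le> B * (inverse (1 + t\<^sup>2) * inverse (1 + x\<^sup>2))"
    using schwartz_decay[OF assms(1)] by blast
  have "((\<lambda>x::real. inverse (1 + x\<^sup>2)) \<longlongrightarrow> 0) F"
    by (rule inverse_1_plus_square_tendsto_0[OF F])
  then have "((\<lambda>x::real. B * (inverse (1 + t\<^sup>2) * inverse (1 + x\<^sup>2))) \<longlongrightarrow> 0) F"
    by (intro tendsto_mult_right_zero)
  then show ?thesis
    by (rule Lim_null_comparison[rotated]) (simp add: norm_mult B)
qed

text \<open>
  Integration by parts in \<open>x\<close> on each line \<open>t = const\<close>: the integrand
  of the difference of the two sides is the \<open>x\<close>-derivative of \<open>e\<^bsup>-i(t\<tau>+x\<xi>)\<^esup> f(t, x)\<close>, which vanishes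
  at infinity.
\<close>
lemma fourier_partial_x:
  assumes f: "f \<in> schwartz"
  shows "fourier (partial_x f) (\<tau>, \<xi>) = \<i> * of_real \<xi> * fourier f (\<tau>, \<xi>)"
proof -
  have f': "partial_x f \<in> schwartz" by (rule schwartz_partial_x[OF f])
  let ?e = "\<lambda>t x. exp (- (\<i> * of_real (t * \<tau> + x * \<xi>)))"
  have integrable: "integrable lborel (\<lambda>x. ?e t x * g (t, x))" if "g \<in> schwartz" for g t
  proof (rule Bochner_Integration.integrable_bound[OF schwartz_integrable_x[OF that, of t]])
    have "continuous_on UNIV (\<lambda>x. ?e t x * g (t, x))"
      by (intro continuous_intros continuous_on_compose2[OF schwartz_continuous[OF that]]) auto
    then show "(\<lambda>x. ?e t x * g (t, x)) \<in> borel_measurable lborel"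
      by (simp add: borel_measurable_continuous_onI)
  qed (simp add: norm_mult)
  have "(LINT x|lborel. ?e t x * partial_x f (t, x)) = \<i> * of_real \<xi> * (LINT x|lborel. ?e t x * f (t, x))" for t
  proof -
    let ?d = "\<lambda>x. ?e t x * partial_x f (t, x) - \<i> * of_real \<xi> * (?e t x * f (t, x))"
    have int: "integrable lborel ?d"
      by (intro Bochner_Integration.integrable_diff integrable_mult_right integrable f f')
    have "(LBINT x=-\<infinity>..\<infinity>. ?d x) = 0 - 0"
    proof (rule interval_integral_FTC_integrable[where F = "\<lambda>x. ?e t x * f (t, x)"])
      show "((\<lambda>x. ?e t x * f (t, x)) has_vector_derivative ?d x) (at x)" for x
      proof -
        have "((\<lambda>z. exp (- (\<i> * (of_real (t * \<tau>) + z * of_real \<xi>)))) has_field_derivative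
            - (\<i> * of_real \<xi>) * exp (- (\<i> * (of_real (t * \<tau>) + of_real x * of_real \<xi>)))) (at (of_real x))"
          by (auto intro!: derivative_eq_intros)
        from has_vector_derivative_mult[OF has_vector_derivative_real_field[OF this] schwartz_has_vector_derivative_x[OF f]]
        show ?thesis
          by (simp add: algebra_simps)
      qed
      have "continuous_on UNIV ?d"
        by (intro continuous_intros continuous_on_compose2[OF schwartz_continuous[OF f]]
            continuous_on_compose2[OF schwartz_continuous[OF f']]) auto
      then show "isCont ?d x" for x
        by (simp add: continuous_on_eq_continuous_at)
      show "set_integrable lborel (einterval (- \<infinity>) \<infinity>) ?d"
        using int by (simp add: set_integrable_def)
      show "(((\<lambda>x. ?e t x * f (t, x)) \<circ> real_of_ereal) \<longlongrightarrow> 0) (at_right (- \<infinity>))"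
        "(((\<lambda>x. ?e t x * f (t, x)) \<circ> real_of_ereal) \<longlongrightarrow> 0) (at_left \<infinity>)"
        unfolding ereal_tendsto_simps1 using schwartz_x_tendsto_0[OF f] by blast+
    qed simp
    then have "(LINT x|lborel. ?d x) = 0"
      by (simp add: interval_lebesgue_integral_def set_lebesgue_integral_def)
    moreover have "(LINT x|lborel. ?d x) = (LINT x|lborel. ?e t x * partial_x f (t, x)) - \<i> * of_real \<xi> * (LINT x|lborel. ?e t x * f (t, x))"
      by (simp only: Bochner_Integration.integral_diff integrable_mult_right integrable f f'
          integral_mult_right_zero)
    ultimately show ?thesis by simp
  qed
  then show ?thesis
    by (simp add: fourier_iterated schwartz_integrable f f')
qed

section \<open>Wave packets\<close>

text \<open>
  The exponents \<open>p\<close> and \<open>q\<close> are the squared widths of the Fourier transform: it lives where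
  \<open>\<bar>\<xi> - \<xi>\<^sub>0\<bar> \<lesssim> \<surd>q\<close> and \<open>\<bar>\<tau> - \<tau>\<^sub>0 - c (\<xi> - \<xi>\<^sub>0)\<bar> \<lesssim> \<surd>p\<close>. The envelope moves with velocity \<open>-c\<close>.
\<close>
definition packet :: "real \<Rightarrow> real \<Rightarrow> real \<Rightarrow> real \<Rightarrow> real \<Rightarrow> real \<times> real \<Rightarrow> complex" where
  "packet \<tau>\<^sub>0 \<xi>\<^sub>0 c p q = (\<lambda>(t, x).
     exp (\<i> * of_real (\<tau>\<^sub>0 * t + \<xi>\<^sub>0 * x) - of_real (p * t\<^sup>2 / 2 + q * (x + c * t)\<^sup>2 / 2)))"

lemma packet_mult:
  "packet \<tau>\<^sub>1 \<xi>\<^sub>1 c p\<^sub>1 q\<^sub>1 z * packet \<tau>\<^sub>2 \<xi>\<^sub>2 c p\<^sub>2 q\<^sub>2 z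
     = packet (\<tau>\<^sub>1 + \<tau>\<^sub>2) (\<xi>\<^sub>1 + \<xi>\<^sub>2) c (p\<^sub>1 + p\<^sub>2) (q\<^sub>1 + q\<^sub>2) z"
proof (cases z)
  case (Pair t x)
  have "\<i> * of_real (\<tau>\<^sub>1 * t + \<xi>\<^sub>1 * x) - of_real (p\<^sub>1 * t\<^sup>2 / 2 + q\<^sub>1 * (x + c * t)\<^sup>2 / 2)
      + (\<i> * of_real (\<tau>\<^sub>2 * t + \<xi>\<^sub>2 * x) - of_real (p\<^sub>2 * t\<^sup>2 / 2 + q\<^sub>2 * (x + c * t)\<^sup>2 / 2))
    = \<i> * of_real ((\<tau>\<^sub>1 + \<tau>\<^sub>2) * t + (\<xi>\<^sub>1 + \<xi>\<^sub>2) * x)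
      - of_real ((p\<^sub>1 + p\<^sub>2) * t\<^sup>2 / 2 + (q\<^sub>1 + q\<^sub>2) * (x + c * t)\<^sup>2 / 2)"
    by (simp add: complex_eq_iff ring_distribs add_divide_distrib)
  then show ?thesis
    by (simp only: Pair packet_def prod.case exp_add[symmetric])
qed

text \<open>
  Complex polynomials in \<open>(t, x)\<close>. Polynomial multiples of a fixed packet are closed under both partial
  derivatives, so that a bound for the whole class covers all derivatives of the packet at once.
\<close>
inductive_set bipoly :: "(real \<times> real \<Rightarrow> complex) set" where
  bipoly_const: "(\<lambda>_. a) \<in> bipoly"
| bipoly_t: "(\<lambda>(t, x). of_real t) \<in> bipoly"
| bipoly_x: "(\<lambda>(t, x). of_real x) \<in> bipoly"
| bipoly_add: "P \<in> bipoly \<Longrightarrow> Q \<in> bipoly \<Longrightarrow> (\<lambda>z. P z + Q z) \<in> bipoly"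
| bipoly_mult: "P \<in> bipoly \<Longrightarrow> Q \<in> bipoly \<Longrightarrow> (\<lambda>z. P z * Q z) \<in> bipoly"

lemma bipoly_has_derivative:
  assumes "P \<in> bipoly"
  shows "\<exists>Pt\<in>bipoly. \<exists>Px\<in>bipoly. \<forall>z. (P has_derivative (\<lambda>h. fst h *\<^sub>R Pt z + snd h *\<^sub>R Px z)) (at z)"
  using assms
proof induction
  case (bipoly_const a)
  show ?case
    by (intro bexI[of _ "\<lambda>_. 0"]) (auto intro: bipoly.intros)
next
  case bipoly_t
  have "((\<lambda>z. of_real (fst z)) has_derivative (\<lambda>h. fst h *\<^sub>R (1::complex) + snd h *\<^sub>R 0)) (at z)"
    for z :: "real \<times> real"
    by (auto intro!: derivative_eq_intros simp: scaleR_conv_of_real)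
  then show ?case
    by (intro bexI[of _ "\<lambda>_. 1"] bexI[of _ "\<lambda>_. 0"])
      (auto intro: bipoly.intros simp: case_prod_unfold)
next
  case bipoly_x
  have "((\<lambda>z. of_real (snd z)) has_derivative (\<lambda>h. fst h *\<^sub>R (0::complex) + snd h *\<^sub>R 1)) (at z)"
    for z :: "real \<times> real"
    by (auto intro!: derivative_eq_intros simp: scaleR_conv_of_real)
  then show ?case
    by (intro bexI[of _ "\<lambda>_. 0"] bexI[of _ "\<lambda>_. 1"])
      (auto intro: bipoly.intros simp: case_prod_unfold)
next
  case (bipoly_add P Q)
  obtain Pt Px where P: "Pt \<in> bipoly" "Px \<in> bipoly"
      "\<And>z. (P has_derivative (\<lambda>h. fst h *\<^sub>R Pt z + snd h *\<^sub>R Px z)) (at z)"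
    using bipoly_add.IH(1) by blast
  obtain Qt Qx where Q: "Qt \<in> bipoly" "Qx \<in> bipoly"
      "\<And>z. (Q has_derivative (\<lambda>h. fst h *\<^sub>R Qt z + snd h *\<^sub>R Qx z)) (at z)"
    using bipoly_add.IH(2) by blast
  note D = P(1,2) Q(1,2) P(3) Q(3)
  have "((\<lambda>z. P z + Q z) has_derivative (\<lambda>h. fst h *\<^sub>R (Pt z + Qt z) + snd h *\<^sub>R (Px z + Qx z))) (at z)" for z
    by (rule has_derivative_eq_rhs[OF has_derivative_add[OF D(5,6)]]) (auto simp: algebra_simps)
  then show ?case
    using D(1-4) by (intro bexI[of _ "\<lambda>z. Pt z + Qt z"] bexI[of _ "\<lambda>z. Px z + Qx z"])
      (auto intro: bipoly.intros)
next
  case (bipoly_mult P Q)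
  obtain Pt Px where P: "Pt \<in> bipoly" "Px \<in> bipoly"
      "\<And>z. (P has_derivative (\<lambda>h. fst h *\<^sub>R Pt z + snd h *\<^sub>R Px z)) (at z)"
    using bipoly_mult.IH(1) by blast
  obtain Qt Qx where Q: "Qt \<in> bipoly" "Qx \<in> bipoly"
      "\<And>z. (Q has_derivative (\<lambda>h. fst h *\<^sub>R Qt z + snd h *\<^sub>R Qx z)) (at z)"
    using bipoly_mult.IH(2) by blast
  note D = P(1,2) Q(1,2) P(3) Q(3)
  have "((\<lambda>z. P z * Q z) has_derivative
      (\<lambda>h. fst h *\<^sub>R (P z * Qt z + Pt z * Q z) + snd h *\<^sub>R (P z * Qx z + Px z * Q z))) (at z)" for z
    by (rule has_derivative_eq_rhs[OF has_derivative_mult[OF D(5,6)]])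
      (auto simp: algebra_simps scaleR_conv_of_real)
  then show ?case
    using bipoly_mult(1,2) D(1-4)
    by (intro bexI[of _ "\<lambda>z. P z * Qt z + Pt z * Q z"] bexI[of _ "\<lambda>z. P z * Qx z + Px z * Q z"])
      (auto intro!: bipoly.intros)
qed

lemma bipoly_bound:
  assumes "P \<in> bipoly"
  shows "\<exists>C\<ge>0. \<exists>n. \<forall>t x. cmod (P (t, x)) \<le> C * ((1 + \<bar>t\<bar>) * (1 + \<bar>x\<bar>)) ^ n"
  using assms
proof induction
  case (bipoly_const a)
  show ?case by (rule exI[of _ "cmod a"], simp, rule exI[of _ 0]) simp
next
  case bipoly_t
  have "\<bar>t\<bar> \<le> (1 + \<bar>t\<bar>) * (1 + \<bar>x\<bar>)" for t x :: real
    by (simp add: algebra_simps)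
  then show ?case by (intro exI[of _ 1] conjI exI[of _ "1::nat"]) auto
next
  case bipoly_x
  have "\<bar>x\<bar> \<le> (1 + \<bar>t\<bar>) * (1 + \<bar>x\<bar>)" for t x :: real
    by (simp add: algebra_simps)
  then show ?case by (intro exI[of _ 1] conjI exI[of _ "1::nat"]) auto
next
  case (bipoly_add P Q)
  obtain C n where C: "C \<ge> 0" "\<And>t x. cmod (P (t, x)) \<le> C * ((1 + \<bar>t\<bar>) * (1 + \<bar>x\<bar>)) ^ n"
    using bipoly_add.IH(1) by blast
  obtain D m where D: "D \<ge> 0" "\<And>t x. cmod (Q (t, x)) \<le> D * ((1 + \<bar>t\<bar>) * (1 + \<bar>x\<bar>)) ^ m"
    using bipoly_add.IH(2) by blast
  note * = C(1) D(1) C(2) D(2)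
  have "cmod (P (t, x) + Q (t, x)) \<le> (C + D) * ((1 + \<bar>t\<bar>) * (1 + \<bar>x\<bar>)) ^ (n + m)" for t x
  proof -
    let ?y = "(1 + \<bar>t\<bar>) * (1 + \<bar>x\<bar>)"
    have y: "?y \<ge> 1" by (simp add: algebra_simps)
    have "C * ?y ^ n \<le> C * ?y ^ (n + m)" "D * ?y ^ m \<le> D * ?y ^ (n + m)"
      by (intro mult_left_mono power_increasing * y; simp)+
    then show ?thesis
      using norm_triangle_ineq[of "P (t, x)" "Q (t, x)"] *(3,4)[of t x]
      unfolding distrib_right by linarith
  qed
  then show ?case
    using *(1,2) by (intro exI[of _ "C + D"] conjI exI[of _ "n + m"]) auto
next
  case (bipoly_mult P Q)
  obtain C n where C: "C \<ge> 0" "\<And>t x. cmod (P (t, x)) \<le> C * ((1 + \<bar>t\<bar>) * (1 + \<bar>x\<bar>)) ^ n"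
    using bipoly_mult.IH(1) by blast
  obtain D m where D: "D \<ge> 0" "\<And>t x. cmod (Q (t, x)) \<le> D * ((1 + \<bar>t\<bar>) * (1 + \<bar>x\<bar>)) ^ m"
    using bipoly_mult.IH(2) by blast
  note * = C(1) D(1) C(2) D(2)
  have "cmod (P (t, x) * Q (t, x)) \<le> (C * D) * ((1 + \<bar>t\<bar>) * (1 + \<bar>x\<bar>)) ^ (n + m)" for t x
    using mult_mono[OF *(3,4)[of t x]] *(1,2) by (simp add: norm_mult power_add mult_ac)
  then show ?case
    using *(1,2) by (intro exI[of _ "C * D"] conjI exI[of _ "n + m"]) auto
qed

lemma bipoly_phase_gradient:
  "(\<lambda>(t, x). \<i> * of_real \<tau>\<^sub>0 - of_real (p * t + q * c * (x + c * t))) \<in> bipoly"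
  "(\<lambda>(t, x). \<i> * of_real \<xi>\<^sub>0 - of_real (q * (x + c * t))) \<in> bipoly"
proof -
  have lin: "(\<lambda>(t, x). a + of_real \<beta> * of_real t + of_real \<gamma> * of_real x) \<in> bipoly" for a :: complex and \<beta> \<gamma> :: real
  proof -
    have "(\<lambda>z. ((\<lambda>_. a) z + (\<lambda>_. of_real \<beta>) z * (\<lambda>(t, x). of_real t) z)
        + (\<lambda>_. of_real \<gamma>) z * (\<lambda>(t, x). of_real x) z) \<in> bipoly"
      by (intro bipoly.intros)
    then show ?thesis by (simp add: case_prod_unfold)
  qed
  show "(\<lambda>(t, x). \<i> * of_real \<tau>\<^sub>0 - of_real (p * t + q * c * (x + c * t))) \<in> bipoly"
    using lin[of "\<i> * of_real \<tau>\<^sub>0" "- p - q * c * c" "- q * c"] by (simp add: algebra_simps)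
  show "(\<lambda>(t, x). \<i> * of_real \<xi>\<^sub>0 - of_real (q * (x + c * t))) \<in> bipoly"
    using lin[of "\<i> * of_real \<xi>\<^sub>0" "- q * c" "- q"] by (simp add: algebra_simps)
qed

lemma packet_has_derivative:
  "(packet \<tau>\<^sub>0 \<xi>\<^sub>0 c p q has_derivative (\<lambda>h.
      fst h *\<^sub>R ((\<i> * of_real \<tau>\<^sub>0 - of_real (p * fst z + q * c * (snd z + c * fst z))) * packet \<tau>\<^sub>0 \<xi>\<^sub>0 c p q z)
    + snd h *\<^sub>R ((\<i> * of_real \<xi>\<^sub>0 - of_real (q * (snd z + c * fst z))) * packet \<tau>\<^sub>0 \<xi>\<^sub>0 c p q z))) (at z)"
proof -
  let ?\<phi> = "\<lambda>z. \<i> * of_real (\<tau>\<^sub>0 * fst z + \<xi>\<^sub>0 * snd z) - of_real (p * (fst z)\<^sup>2 / 2 + q * (snd z + c * fst z)\<^sup>2 / 2)"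
  let ?\<phi>' = "\<lambda>h. \<i> * of_real (\<tau>\<^sub>0 * fst h + \<xi>\<^sub>0 * snd h) - of_real (p * fst z * fst h + q * (snd z + c * fst z) * (snd h + c * fst h))"
  have "(?\<phi> has_derivative ?\<phi>') (at z)"
  proof -
    have "((\<lambda>z. p * (fst z)\<^sup>2 / 2 + q * (snd z + c * fst z)\<^sup>2 / 2) has_derivative
        (\<lambda>h. p * fst z * fst h + q * (snd z + c * fst z) * (snd h + c * fst h))) (at z)"
      by (rule has_derivative_eq_rhs, (rule derivative_intros | simp)+) (simp add: fun_eq_iff)
    moreover have "((\<lambda>z. \<tau>\<^sub>0 * fst z + \<xi>\<^sub>0 * snd z) has_derivative (\<lambda>h. \<tau>\<^sub>0 * fst h + \<xi>\<^sub>0 * snd h)) (at z)"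
      by (intro derivative_intros)
    ultimately show ?thesis
      by (intro has_derivative_diff has_derivative_mult_right has_derivative_of_real)
  qed
  from has_derivative_compose[OF this DERIV_exp[unfolded has_field_derivative_def]]
  have D: "(packet \<tau>\<^sub>0 \<xi>\<^sub>0 c p q has_derivative (\<lambda>h. packet \<tau>\<^sub>0 \<xi>\<^sub>0 c p q z * ?\<phi>' h)) (at z)"
    unfolding packet_def case_prod_unfold .
  have "e * ?\<phi>' h =
      fst h *\<^sub>R ((\<i> * of_real \<tau>\<^sub>0 - of_real (p * fst z + q * c * (snd z + c * fst z))) * e)
    + snd h *\<^sub>R ((\<i> * of_real \<xi>\<^sub>0 - of_real (q * (snd z + c * fst z))) * e)" for e h
    by (simp add: scaleR_conv_of_real ring_distribs mult_ac)
  then show ?thesis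
    using D by (simp only:)
qed

definition packet_poly :: "real \<Rightarrow> real \<Rightarrow> real \<Rightarrow> real \<Rightarrow> real \<Rightarrow> (real \<times> real \<Rightarrow> complex) set" where
  "packet_poly \<tau>\<^sub>0 \<xi>\<^sub>0 c p q = (\<lambda>P z. P z * packet \<tau>\<^sub>0 \<xi>\<^sub>0 c p q z) ` bipoly"

lemma packet_poly_has_derivative:
  assumes "f \<in> packet_poly \<tau>\<^sub>0 \<xi>\<^sub>0 c p q"
  shows "\<exists>ft\<in>packet_poly \<tau>\<^sub>0 \<xi>\<^sub>0 c p q. \<exists>fx\<in>packet_poly \<tau>\<^sub>0 \<xi>\<^sub>0 c p q.
           \<forall>z. (f has_derivative (\<lambda>h. fst h *\<^sub>R ft z + snd h *\<^sub>R fx z)) (at z)"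
proof -
  let ?E = "packet \<tau>\<^sub>0 \<xi>\<^sub>0 c p q"
  obtain P where P: "P \<in> bipoly" "f = (\<lambda>z. P z * ?E z)"
    using assms by (auto simp: packet_poly_def)
  obtain Pt Px where D: "Pt \<in> bipoly" "Px \<in> bipoly"
    "\<And>z. (P has_derivative (\<lambda>h. fst h *\<^sub>R Pt z + snd h *\<^sub>R Px z)) (at z)"
    using bipoly_has_derivative[OF P(1)] by blast
  define Lt where "Lt = (\<lambda>(t, x). \<i> * of_real \<tau>\<^sub>0 - of_real (p * t + q * c * (x + c * t)))"
  define Lx where "Lx = (\<lambda>(t, x). \<i> * of_real \<xi>\<^sub>0 - of_real (q * (x + c * t)))"
  have L: "Lt \<in> bipoly" "Lx \<in> bipoly"
    unfolding Lt_def Lx_def by (rule bipoly_phase_gradient)+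
  have E: "(?E has_derivative (\<lambda>h. fst h *\<^sub>R (Lt z * ?E z) + snd h *\<^sub>R (Lx z * ?E z))) (at z)" for z
    using packet_has_derivative[of \<tau>\<^sub>0 \<xi>\<^sub>0 c p q z] by (simp add: Lt_def Lx_def case_prod_unfold)
  show ?thesis
  proof (intro bexI allI)
    show "(f has_derivative (\<lambda>h. fst h *\<^sub>R ((P z * Lt z + Pt z) * ?E z) + snd h *\<^sub>R ((P z * Lx z + Px z) * ?E z))) (at z)" for z
      unfolding P(2)
      by (rule has_derivative_eq_rhs[OF has_derivative_mult[OF D(3) E]])
        (auto simp: algebra_simps scaleR_conv_of_real)
    show "(\<lambda>z. (P z * Lt z + Pt z) * ?E z) \<in> packet_poly \<tau>\<^sub>0 \<xi>\<^sub>0 c p q"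
      "(\<lambda>z. (P z * Lx z + Px z) * ?E z) \<in> packet_poly \<tau>\<^sub>0 \<xi>\<^sub>0 c p q"
      unfolding packet_poly_def
      by (rule imageI[where f = "\<lambda>P z. P z * ?E z"], intro bipoly.intros P D L)+
  qed
qed

lemma partial_of_has_derivative:
  assumes "\<And>z. (f has_derivative (\<lambda>h. fst h *\<^sub>R ft z + snd h *\<^sub>R fx z)) (at z)"
  shows "partial_t f = ft" "partial_x f = fx"
proof -
  have "((\<lambda>t'. f (t', x)) has_vector_derivative ft (t, x)) (at t)" for t x
  proof -
    have "((\<lambda>t'. (t', x)) has_derivative (\<lambda>h. (h, 0))) (at t)"
      by (auto intro!: derivative_eq_intros)
    from has_derivative_compose[OF this assms] show ?thesis
      by (simp add: has_vector_derivative_def)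
  qed
  then show "partial_t f = ft"
    by (auto simp: partial_t_def fun_eq_iff vector_derivative_at)
  have "((\<lambda>x'. f (t, x')) has_vector_derivative fx (t, x)) (at x)" for t x
  proof -
    have "((\<lambda>x'. (t, x')) has_derivative (\<lambda>h. (0, h))) (at x)"
      by (auto intro!: derivative_eq_intros)
    from has_derivative_compose[OF this assms] show ?thesis
      by (simp add: has_vector_derivative_def)
  qed
  then show "partial_x f = fx"
    by (auto simp: partial_x_def fun_eq_iff vector_derivative_at)
qed

lemma packet_poly_partial:
  assumes "f \<in> packet_poly \<tau>\<^sub>0 \<xi>\<^sub>0 c p q"
  shows "partial_t f \<in> packet_poly \<tau>\<^sub>0 \<xi>\<^sub>0 c p q" "partial_x f \<in> packet_poly \<tau>\<^sub>0 \<xi>\<^sub>0 c p q"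
    and "f differentiable_on UNIV"
proof -
  obtain ft fx where D: "ft \<in> packet_poly \<tau>\<^sub>0 \<xi>\<^sub>0 c p q" "fx \<in> packet_poly \<tau>\<^sub>0 \<xi>\<^sub>0 c p q"
    "\<And>z. (f has_derivative (\<lambda>h. fst h *\<^sub>R ft z + snd h *\<^sub>R fx z)) (at z)"
    using packet_poly_has_derivative[OF assms] by blast
  show "partial_t f \<in> packet_poly \<tau>\<^sub>0 \<xi>\<^sub>0 c p q" "partial_x f \<in> packet_poly \<tau>\<^sub>0 \<xi>\<^sub>0 c p q"
    using partial_of_has_derivative[OF D(3)] D(1,2) by simp_all
  show "f differentiable_on UNIV"
    unfolding differentiable_on_def using D(3) by (blast intro: differentiableI)
qed

text \<open>
  From \<open>1 + \<bar>t\<bar> \<le> e\<^bsup>\<bar>t\<bar>\<^esup>\<close> and completing the square in \<open>n \<bar>t\<bar> - k t\<^sup>2\<close>.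
\<close>
lemma power_le_exp_square:
  fixes k t :: real
  assumes "k > 0"
  shows "(1 + \<bar>t\<bar>) ^ n \<le> exp (real n ^ 2 / (4 * k)) * exp (k * t\<^sup>2)"
proof -
  have "(1 + \<bar>t\<bar>) ^ n \<le> exp \<bar>t\<bar> ^ n"
    by (intro power_mono exp_ge_add_one_self) auto
  also have "\<dots> = exp (real n * \<bar>t\<bar>)"
    by (simp add: exp_of_nat_mult)
  also have "real n * \<bar>t\<bar> \<le> real n ^ 2 / (4 * k) + k * t\<^sup>2"
  proof -
    have "0 \<le> (real n - 2 * k * \<bar>t\<bar>)\<^sup>2" by simp
    then have "4 * k * (real n * \<bar>t\<bar>) \<le> real n ^ 2 + 4 * k * (k * t\<^sup>2)"
      by (simp add: power2_diff power_mult_distrib algebra_simps power2_eq_square)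
    then show ?thesis
      using assms by (simp add: field_simps)
  qed
  then have "exp (real n * \<bar>t\<bar>) \<le> exp (real n ^ 2 / (4 * k) + k * t\<^sup>2)" by simp
  finally show ?thesis by (simp add: exp_add)
qed

lemma norm_packet: "cmod (packet \<tau>\<^sub>0 \<xi>\<^sub>0 c p q (t, x)) = exp (- (p / 2 * t\<^sup>2)) * exp (- (q / 2 * (x + c * t)\<^sup>2))"
  by (simp add: packet_def exp_add[symmetric] algebra_simps)

text \<open>
  The Gaussian decays in \<open>t\<close> and in \<open>y = x + c t\<close> rather than in \<open>x\<close>; since \<open>x = y - c t\<close>, a power of
  \<open>1 + \<bar>x\<bar>\<close> costs at most the same powers of \<open>1 + \<bar>t\<bar>\<close> and \<open>1 + \<bar>y\<bar>\<close>.
\<close>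
lemma packet_rapid_decay:
  assumes "p > 0" "q > 0"
  shows "\<exists>B. \<forall>t x. ((1 + \<bar>t\<bar>) * (1 + \<bar>x\<bar>)) ^ n * cmod (packet \<tau>\<^sub>0 \<xi>\<^sub>0 c p q (t, x)) \<le> B"
proof (intro exI allI)
  fix t x
  let ?y = "x + c * t"
  have "1 + \<bar>x\<bar> \<le> (1 + \<bar>c\<bar>) * (1 + \<bar>t\<bar>) * (1 + \<bar>?y\<bar>)"
  proof -
    have "\<bar>x\<bar> \<le> \<bar>?y\<bar> + \<bar>c * t\<bar>" by linarith
    also have "\<dots> \<le> (1 + \<bar>c\<bar>) * (1 + \<bar>t\<bar>) * (1 + \<bar>?y\<bar>) - 1"
      by (simp add: algebra_simps abs_mult)
    finally show ?thesis by simp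
  qed
  then have "(1 + \<bar>t\<bar>) * (1 + \<bar>x\<bar>) \<le> (1 + \<bar>t\<bar>) * ((1 + \<bar>c\<bar>) * (1 + \<bar>t\<bar>) * (1 + \<bar>?y\<bar>))"
    by (intro mult_left_mono) auto
  also have "\<dots> = (1 + \<bar>c\<bar>) * (1 + \<bar>t\<bar>) ^ 2 * (1 + \<bar>?y\<bar>)"
    by (simp only: power2_eq_square mult_ac)
  finally have "((1 + \<bar>t\<bar>) * (1 + \<bar>x\<bar>)) ^ n \<le> ((1 + \<bar>c\<bar>) * (1 + \<bar>t\<bar>) ^ 2 * (1 + \<bar>?y\<bar>)) ^ n"
    by (rule power_mono) simp
  also have "\<dots> = (1 + \<bar>c\<bar>) ^ n * ((1 + \<bar>t\<bar>) ^ (2 * n) * (1 + \<bar>?y\<bar>) ^ n)"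
    unfolding power_mult_distrib power_mult by (simp only: mult_ac)
  also have "\<dots> \<le> (1 + \<bar>c\<bar>) ^ n * ((exp (real (2 * n) ^ 2 / (4 * (p / 2))) * exp (p / 2 * t\<^sup>2)) *
      (exp (real n ^ 2 / (4 * (q / 2))) * exp (q / 2 * ?y\<^sup>2)))"
    using assms by (intro mult_left_mono mult_mono power_le_exp_square) auto
  finally have "((1 + \<bar>t\<bar>) * (1 + \<bar>x\<bar>)) ^ n * cmod (packet \<tau>\<^sub>0 \<xi>\<^sub>0 c p q (t, x)) \<le> \<dots> * cmod (packet \<tau>\<^sub>0 \<xi>\<^sub>0 c p q (t, x))"
    by (rule mult_right_mono) simp
  also have "\<dots> = (1 + \<bar>c\<bar>) ^ n * exp (real (2 * n) ^ 2 / (4 * (p / 2))) * exp (real n ^ 2 / (4 * (q / 2)))"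
    unfolding norm_packet by (simp add: exp_minus field_simps)
  finally show "((1 + \<bar>t\<bar>) * (1 + \<bar>x\<bar>)) ^ n * cmod (packet \<tau>\<^sub>0 \<xi>\<^sub>0 c p q (t, x)) \<le>
    (1 + \<bar>c\<bar>) ^ n * exp (real (2 * n) ^ 2 / (4 * (p / 2))) * exp (real n ^ 2 / (4 * (q / 2)))" .
qed

lemma packet_poly_rapid_decay:
  assumes "f \<in> packet_poly \<tau>\<^sub>0 \<xi>\<^sub>0 c p q" "p > 0" "q > 0"
  shows "bounded (range (\<lambda>(t, x). (t ^ k * x ^ l) *\<^sub>R f (t, x)))"
proof -
  let ?E = "packet \<tau>\<^sub>0 \<xi>\<^sub>0 c p q"
  obtain P where P: "P \<in> bipoly" "f = (\<lambda>z. P z * ?E z)"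
    using assms by (auto simp: packet_poly_def)
  obtain C n where C: "C \<ge> 0" "\<And>t x. cmod (P (t, x)) \<le> C * ((1 + \<bar>t\<bar>) * (1 + \<bar>x\<bar>)) ^ n"
    using bipoly_bound[OF P(1)] by blast
  obtain B where B: "\<And>t x. ((1 + \<bar>t\<bar>) * (1 + \<bar>x\<bar>)) ^ (k + l + n) * cmod (?E (t, x)) \<le> B"
    using packet_rapid_decay[OF assms(2,3)] by blast
  have "cmod ((t ^ k * x ^ l) *\<^sub>R f (t, x)) \<le> C * B" for t x
  proof -
    let ?y = "(1 + \<bar>t\<bar>) * (1 + \<bar>x\<bar>)"
    have "\<bar>t\<bar> \<le> ?y" "\<bar>x\<bar> \<le> ?y" by (simp_all add: algebra_simps)
    then have "\<bar>t\<bar> ^ k * \<bar>x\<bar> ^ l * cmod (P (t, x)) \<le> ?y ^ k * ?y ^ l * (C * ?y ^ n)"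
      by (intro mult_mono power_mono C) (auto intro!: mult_nonneg_nonneg)
    then have "\<bar>t\<bar> ^ k * \<bar>x\<bar> ^ l * cmod (P (t, x)) * cmod (?E (t, x)) \<le> C * ?y ^ (k + l + n) * cmod (?E (t, x))"
      by (intro mult_right_mono) (auto simp: power_add mult_ac)
    also have "\<dots> \<le> C * B"
      using mult_left_mono[OF B C(1)] by (simp add: mult_ac)
    finally show ?thesis
      by (simp add: P(2) norm_mult abs_mult power_abs mult_ac)
  qed
  then show ?thesis by (auto simp: bounded_iff)
qed

lemma packet_in_schwartz:
  assumes "p > 0" "q > 0"
  shows "packet \<tau>\<^sub>0 \<xi>\<^sub>0 c p q \<in> schwartz"
proof -
  let ?S = "packet_poly \<tau>\<^sub>0 \<xi>\<^sub>0 c p q"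
  have "(\<lambda>z. (\<lambda>_. 1) z * packet \<tau>\<^sub>0 \<xi>\<^sub>0 c p q z) \<in> ?S"
    unfolding packet_poly_def by (rule imageI, rule bipoly_const)
  then have "packet \<tau>\<^sub>0 \<xi>\<^sub>0 c p q \<in> ?S" by simp
  then have "(partial_x ^^ j) (packet \<tau>\<^sub>0 \<xi>\<^sub>0 c p q) \<in> ?S" for j
    by (induction j) (auto intro: packet_poly_partial)
  then have "(partial_t ^^ i) ((partial_x ^^ j) (packet \<tau>\<^sub>0 \<xi>\<^sub>0 c p q)) \<in> ?S" for i j
    by (induction i) (auto intro: packet_poly_partial)
  then show ?thesis
    unfolding schwartz_def
    using packet_poly_partial(3) packet_poly_rapid_decay[OF _ assms] by blast
qed

text \<open>
  A rescaling of the characteristic function of the standard normal distribution.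
\<close>
lemma fourier_gaussian_1d:
  assumes "q > 0"
  shows "(LINT x|lborel. exp (- (\<i> * of_real (x * \<xi>))) * of_real (exp (- (q * x\<^sup>2 / 2))))
           = of_real (sqrt (2 * pi / q) * exp (- (\<xi>\<^sup>2 / (2 * q))))"
proof -
  let ?r = "sqrt q"
  have r: "?r > 0" "?r \<noteq> 0" "?r ^ 2 = q" using assms by auto
  have "char std_normal_distribution (- \<xi> / ?r) = of_real (exp (- (\<xi>\<^sup>2 / (2 * q))))"
    using r by (simp add: char_std_normal_distribution power_divide)
  moreover have "char std_normal_distribution (- \<xi> / ?r) =
      (LINT y|lborel. std_normal_density y *\<^sub>R exp (\<i> * of_real (- \<xi> / ?r * y)))"
    unfolding char_def
    by (subst integral_density) (auto simp: normal_density_nonneg)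
  moreover have "\<dots> = ?r *\<^sub>R (LINT x|lborel. std_normal_density (?r * x) *\<^sub>R exp (\<i> * of_real (- \<xi> / ?r * (?r * x))))"
    using lborel_integral_real_affine[of ?r "\<lambda>y. std_normal_density y *\<^sub>R exp (\<i> * of_real (- \<xi> / ?r * y))" 0] r
    by simp
  moreover have "(\<lambda>x. std_normal_density (?r * x) *\<^sub>R exp (\<i> * of_real (- \<xi> / ?r * (?r * x))))
      = (\<lambda>x. of_real (1 / sqrt (2 * pi)) * (exp (- (\<i> * of_real (x * \<xi>))) * of_real (exp (- (q * x\<^sup>2 / 2)))))"
    using r by (auto simp: std_normal_density_def scaleR_conv_of_real power_mult_distrib mult_ac fun_eq_iff)
  ultimately have "of_real (exp (- (\<xi>\<^sup>2 / (2 * q)))) = ?r *\<^sub>R (of_real (1 / sqrt (2 * pi)) *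
      (LINT x|lborel. exp (- (\<i> * of_real (x * \<xi>))) * of_real (exp (- (q * x\<^sup>2 / 2)))))"
    by (simp only: integral_mult_right_zero)
  then show ?thesis
    using r by (simp add: scaleR_conv_of_real real_sqrt_divide)
qed

text \<open>
  The substitution \<open>y = x + c t\<close> separates the variables, at the price of replacing the frequency
  \<open>\<tau> - \<tau>\<^sub>0\<close> dual to \<open>t\<close> by \<open>\<tau> - \<tau>\<^sub>0 - c (\<xi> - \<xi>\<^sub>0)\<close>.
\<close>
lemma norm_fourier_packet:
  assumes "p > 0" "q > 0"
  shows "cmod (fourier (packet \<tau>\<^sub>0 \<xi>\<^sub>0 c p q) (\<tau>, \<xi>)) =
    2 * pi / sqrt (p * q) * exp (- ((\<tau> - \<tau>\<^sub>0 - c * (\<xi> - \<xi>\<^sub>0))\<^sup>2 / (2 * p)) - (\<xi> - \<xi>\<^sub>0)\<^sup>2 / (2 * q))"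
proof -
  let ?E = "packet \<tau>\<^sub>0 \<xi>\<^sub>0 c p q"
  let ?\<zeta> = "\<xi> - \<xi>\<^sub>0" and ?u = "\<tau> - \<tau>\<^sub>0 - c * (\<xi> - \<xi>\<^sub>0)"
  let ?g = "of_real (sqrt (2 * pi / q) * exp (- (?\<zeta>\<^sup>2 / (2 * q)))) :: complex"
  have inner: "(LINT x|lborel. exp (- (\<i> * of_real (t * \<tau> + x * \<xi>))) * ?E (t, x))
      = exp (- (\<i> * of_real (t * ?u))) * of_real (exp (- (p * t\<^sup>2 / 2))) * ?g" for t
  proof -
    have "(LINT x|lborel. exp (- (\<i> * of_real (t * \<tau> + x * \<xi>))) * ?E (t, x))
       = (LINT y|lborel. exp (- (\<i> * of_real (t * \<tau> + (- c * t + y) * \<xi>))) * ?E (t, - c * t + y))"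
      using lborel_integral_real_affine[of 1 "\<lambda>x. exp (- (\<i> * of_real (t * \<tau> + x * \<xi>))) * ?E (t, x)" "- c * t"]
      by simp
    also have "\<dots> = (LINT y|lborel. exp (- (\<i> * of_real (t * ?u))) * of_real (exp (- (p * t\<^sup>2 / 2))) *
        (exp (- (\<i> * of_real (y * ?\<zeta>))) * of_real (exp (- (q * y\<^sup>2 / 2)))))"
      by (intro Bochner_Integration.integral_cong refl)
        (simp add: packet_def exp_of_real[symmetric] exp_add[symmetric] algebra_simps)
    also have "\<dots> = exp (- (\<i> * of_real (t * ?u))) * of_real (exp (- (p * t\<^sup>2 / 2))) * ?g"
      by (simp only: integral_mult_right_zero fourier_gaussian_1d[OF assms(2)])
    finally show ?thesis .
  qed
  have "fourier ?E (\<tau>, \<xi>) = of_real (sqrt (2 * pi / p) * exp (- (?u\<^sup>2 / (2 * p)))) * ?g"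
    by (simp only: fourier_iterated[OF schwartz_integrable[OF packet_in_schwartz[OF assms]]] inner
        integral_mult_left_zero fourier_gaussian_1d[OF assms(1)])
  moreover have "sqrt (2 * pi / p) * sqrt (2 * pi / q) = 2 * pi / sqrt (p * q)"
    using real_sqrt_mult_self[of "2 * pi"] by (simp add: real_sqrt_divide real_sqrt_mult[of p])
  moreover have "sqrt (2 * pi / p) * exp (- (?u\<^sup>2 / (2 * p))) * (sqrt (2 * pi / q) * exp (- (?\<zeta>\<^sup>2 / (2 * q))))
      = sqrt (2 * pi / p) * sqrt (2 * pi / q) * exp (- (?u\<^sup>2 / (2 * p)) - ?\<zeta>\<^sup>2 / (2 * q))"
    unfolding diff_conv_add_uminus exp_add by (simp only: mult_ac)
  ultimately have "fourier ?E (\<tau>, \<xi>)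
      = of_real (2 * pi / sqrt (p * q) * exp (- (?u\<^sup>2 / (2 * p)) - ?\<zeta>\<^sup>2 / (2 * q)))"
    by (simp only: of_real_mult[symmetric])
  then show ?thesis
    using assms by (simp only: norm_of_real) (simp add: abs_mult)
qed

section \<open>Norms of wave packets in the rescaled frequency variables\<close>

lemma integrable_power_gaussian:
  "integrable lborel (\<lambda>x::real. (1 + \<bar>x\<bar>) ^ n * exp (- x\<^sup>2))"
proof -
  have "(1 + \<bar>x\<bar>) ^ n * exp (- x\<^sup>2) \<le> exp (real (n + 2) ^ 2 / 4) * inverse (1 + x\<^sup>2)" for x :: real
  proof -
    have pos: "1 + x\<^sup>2 > 0" by (auto intro: add_pos_nonneg)
    have "(1 + \<bar>x\<bar>) ^ n * (1 + x\<^sup>2) \<le> (1 + \<bar>x\<bar>) ^ n * (1 + \<bar>x\<bar>)\<^sup>2"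
      by (intro mult_left_mono) (auto simp: power2_sum)
    also have "\<dots> \<le> exp (real (n + 2) ^ 2 / 4) * exp (x\<^sup>2)"
      using power_le_exp_square[of 1 x "n + 2"] unfolding power_add by simp
    finally show ?thesis
      using pos by (simp add: exp_minus divide_simps mult_ac)
  qed
  moreover have "integrable lborel (\<lambda>x::real. exp (real (n + 2) ^ 2 / 4) * inverse (1 + x\<^sup>2))"
    by (intro integrable_mult_right integrable_inverse_1_plus_square')
  ultimately show ?thesis
    by (elim Bochner_Integration.integrable_bound) (auto simp: abs_mult)
qed

definition gaussian_majorant :: "nat \<Rightarrow> nat \<Rightarrow> real \<times> real \<Rightarrow> real" where
  "gaussian_majorant n m = (\<lambda>(w, \<eta>). ((1 + \<bar>w\<bar>) ^ n * exp (- w\<^sup>2)) * ((1 + \<bar>\<eta>\<bar>) ^ m * exp (- \<eta>\<^sup>2)))"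

lemma integrable_gaussian_majorant: "integrable lborel (gaussian_majorant n m)"
  unfolding gaussian_majorant_def
  by (intro integrable_product_lborel integrable_power_gaussian)

lemma gaussian_majorant_nonneg: "gaussian_majorant n m z \<ge> 0"
  by (simp add: gaussian_majorant_def case_prod_unfold)

text \<open>
  The value of \<open>\<tau> - \<alpha> \<xi>\<^sup>3\<close> at \<open>\<xi> = \<xi>\<^sub>0 + \<surd>q \<eta>\<close> and \<open>\<tau> = \<alpha> \<xi>\<^sub>0\<^sup>3 + c \<surd>q \<eta> + \<surd>p w\<close>: the centre is on the curve,
  and the coefficient of the linear term in \<open>\<eta>\<close> compares the slope \<open>c\<close> with that of the curve.
\<close>
definition modulation :: "real \<Rightarrow> real \<Rightarrow> real \<Rightarrow> real \<Rightarrow> real \<Rightarrow> real \<Rightarrow> real \<Rightarrow> real" where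
  "modulation \<alpha> \<xi>\<^sub>0 c p q w \<eta> =
     sqrt p * w + (c - 3 * \<alpha> * \<xi>\<^sub>0\<^sup>2) * sqrt q * \<eta> - 3 * \<alpha> * \<xi>\<^sub>0 * q * \<eta>\<^sup>2 - \<alpha> * sqrt q ^ 3 * \<eta> ^ 3"

text \<open>
  The integrand of the squared norm, up to a constant, for a function whose Fourier transform is
  \<open>m(\<xi>)\<close> times that of a packet centred on the curve. The multiplier
  is \<open>1\<close> for a packet and \<open>\<bar>\<xi>\<bar>\<close> for its \<open>x\<close>-derivative.
\<close>
definition packet_density where
  "packet_density m \<alpha> s b \<xi>\<^sub>0 c p q = (\<lambda>(w, \<eta>).
     (m (\<xi>\<^sub>0 + sqrt q * \<eta>) * \<langle>\<xi>\<^sub>0 + sqrt q * \<eta>\<rangle> powr s * \<langle>modulation \<alpha> \<xi>\<^sub>0 c p q w \<eta>\<rangle> powr b)\<^sup>2 * exp (- w\<^sup>2 - \<eta>\<^sup>2))"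

lemma borel_measurable_packet_density:
  assumes [measurable]: "m \<in> borel_measurable borel"
  shows "packet_density m \<alpha> s b \<xi>\<^sub>0 c p q \<in> borel_measurable borel"
proof -
  have "packet_density m \<alpha> s b \<xi>\<^sub>0 c p q \<in> borel_measurable (borel \<Otimes>\<^sub>M borel)"
    unfolding packet_density_def modulation_def bracket_def by measurable
  then show ?thesis by (simp add: borel_prod)
qed

text \<open>
  The change of variables to \<open>w = (\<tau> - \<alpha> \<xi>\<^sub>0\<^sup>3 - c (\<xi> - \<xi>\<^sub>0)) / \<surd>p\<close> and \<open>\<eta> = (\<xi> - \<xi>\<^sub>0) / \<surd>q\<close>. Its Jacobian \<open>\<surd>(pq)\<close>
  cancels half of the factor \<open>1/(pq)\<close> of the squared Fourier transform.
\<close>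
lemma X_norm_packet_eq:
  assumes "p > 0" "q > 0" and [measurable]: "m \<in> borel_measurable borel"
    and f: "\<And>\<tau> \<xi>. cmod (fourier f (\<tau>, \<xi>)) = m \<xi> * cmod (fourier (packet (\<alpha> * \<xi>\<^sub>0 ^ 3) \<xi>\<^sub>0 c p q) (\<tau>, \<xi>))"
  shows "(X_norm \<alpha> s b f)\<^sup>2 = 4 * pi\<^sup>2 / sqrt (p * q) * integral\<^sup>L lborel (packet_density m \<alpha> s b \<xi>\<^sub>0 c p q)"
proof -
  let ?G = "\<lambda>(\<tau>, \<xi>). (\<langle>\<xi>\<rangle> powr s * \<langle>\<tau> - \<alpha> * \<xi> ^ 3\<rangle> powr b * cmod (fourier f (\<tau>, \<xi>)))\<^sup>2"
  let ?S = "\<lambda>(w, \<eta>). (\<alpha> * \<xi>\<^sub>0 ^ 3 + c * (sqrt q * \<eta>) + sqrt p * w, \<xi>\<^sub>0 + sqrt q * \<eta>)"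
  have pq: "sqrt p > 0" "sqrt q > 0" "(sqrt p)\<^sup>2 = p" "(sqrt q)\<^sup>2 = q" using assms by auto
  have G: "?G = (\<lambda>(\<tau>, \<xi>). (\<langle>\<xi>\<rangle> powr s * \<langle>\<tau> - \<alpha> * \<xi> ^ 3\<rangle> powr b * (m \<xi> * (2 * pi / sqrt (p * q) *
      exp (- ((\<tau> - \<alpha> * \<xi>\<^sub>0 ^ 3 - c * (\<xi> - \<xi>\<^sub>0))\<^sup>2 / (2 * p)) - (\<xi> - \<xi>\<^sub>0)\<^sup>2 / (2 * q)))))\<^sup>2)" (is "_ = ?H")
    by (simp add: f norm_fourier_packet[OF assms(1,2)])
  have "?H \<in> borel_measurable (borel \<Otimes>\<^sub>M borel)"
    unfolding bracket_def by measurable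
  then have meas: "?G \<in> borel_measurable borel"
    unfolding G borel_prod .
  have "?G (?S z) = 4 * pi\<^sup>2 / (p * q) * packet_density m \<alpha> s b \<xi>\<^sub>0 c p q z" for z
  proof (cases z)
    case (Pair w \<eta>)
    have 1: "\<alpha> * \<xi>\<^sub>0 ^ 3 + c * (sqrt q * \<eta>) + sqrt p * w - \<alpha> * (\<xi>\<^sub>0 + sqrt q * \<eta>) ^ 3 = modulation \<alpha> \<xi>\<^sub>0 c p q w \<eta>"
    proof -
      have "3 * \<alpha> * \<xi>\<^sub>0 * q * \<eta>\<^sup>2 = 3 * \<alpha> * \<xi>\<^sub>0 * (sqrt q)\<^sup>2 * \<eta>\<^sup>2" using pq by simp
      then show ?thesis
        unfolding modulation_def by (simp only:) (simp add: algebra_simps power2_eq_square power3_eq_cube)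
    qed
    have 2: "(exp (- ((sqrt p * w)\<^sup>2 / (2 * p)) - (sqrt q * \<eta>)\<^sup>2 / (2 * q)))\<^sup>2 = exp (- w\<^sup>2 - \<eta>\<^sup>2)"
      using assms(1,2) by (simp add: power_mult_distrib exp_double[symmetric] algebra_simps)
    have 3: "(2 * pi / sqrt (p * q))\<^sup>2 = 4 * pi\<^sup>2 / (p * q)"
      using assms(1,2) by (simp add: power_divide power_mult_distrib)
    have "?G (?S z) = (\<langle>\<xi>\<^sub>0 + sqrt q * \<eta>\<rangle> powr s * \<langle>modulation \<alpha> \<xi>\<^sub>0 c p q w \<eta>\<rangle> powr b * (m (\<xi>\<^sub>0 + sqrt q * \<eta>) *
       (2 * pi / sqrt (p * q) * exp (- ((sqrt p * w)\<^sup>2 / (2 * p)) - (sqrt q * \<eta>)\<^sup>2 / (2 * q)))))\<^sup>2"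
      unfolding G Pair prod.case 1 by simp
    also have "\<dots> = (m (\<xi>\<^sub>0 + sqrt q * \<eta>) * \<langle>\<xi>\<^sub>0 + sqrt q * \<eta>\<rangle> powr s * \<langle>modulation \<alpha> \<xi>\<^sub>0 c p q w \<eta>\<rangle> powr b)\<^sup>2
        * ((2 * pi / sqrt (p * q))\<^sup>2 * (exp (- ((sqrt p * w)\<^sup>2 / (2 * p)) - (sqrt q * \<eta>)\<^sup>2 / (2 * q)))\<^sup>2)"
      by (simp only: power_mult_distrib mult_ac)
    also have "\<dots> = 4 * pi\<^sup>2 / (p * q) * packet_density m \<alpha> s b \<xi>\<^sub>0 c p q z"
      unfolding 2 3 Pair packet_density_def prod.case by (simp only: mult_ac)
    finally show ?thesis .
  qed
  moreover have "integral\<^sup>L lborel ?G = \<bar>sqrt p * sqrt q\<bar> * (LINT z|lborel. ?G (?S z))"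
    by (rule lborel_integral_shear_affine[OF meas]) (use pq in auto)
  ultimately have "integral\<^sup>L lborel ?G = sqrt (p * q) * (4 * pi\<^sup>2 / (p * q) * integral\<^sup>L lborel (packet_density m \<alpha> s b \<xi>\<^sub>0 c p q))"
    using pq by (simp add: real_sqrt_mult)
  also have "\<dots> = 4 * pi\<^sup>2 / sqrt (p * q) * integral\<^sup>L lborel (packet_density m \<alpha> s b \<xi>\<^sub>0 c p q)"
  proof -
    have "r * (K / (r * r) * I) = K / r * I" if "r \<noteq> 0" for r K I :: real
      using that by simp
    from this[of "sqrt (p * q)"] show ?thesis
      using assms(1,2) by simp
  qed
  finally have eq: "integral\<^sup>L lborel ?G = 4 * pi\<^sup>2 / sqrt (p * q) * integral\<^sup>L lborel (packet_density m \<alpha> s b \<xi>\<^sub>0 c p q)" .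
  have "integral\<^sup>L lborel ?G \<ge> 0"
    by (intro Bochner_Integration.integral_nonneg) auto
  then show ?thesis
    unfolding X_norm_def using eq by simp
qed

lemma bracket_ge_1: "\<langle>y\<rangle> \<ge> 1"
  by (simp add: bracket_def)

text \<open>
  The bound is a polynomial in \<open>(w, \<eta>)\<close> whose coefficient stays bounded as \<open>\<bar>\<xi>\<^sub>0\<bar> \<rightarrow> \<infinity>\<close> provided that the packet
  is short (\<open>\<bar>\<xi>\<^sub>0\<bar> q \<lesssim> 1\<close>) and its slope differs from that of the curve by at most about
  \<open>1/\<surd>q\<close>.
\<close>
lemma bracket_modulation_le:
  assumes "q > 0" "p > 0"
  shows "\<langle>modulation \<alpha> \<xi>\<^sub>0 c p q w \<eta>\<rangle> \<le>
    (1 + sqrt p + \<bar>c - 3 * \<alpha> * \<xi>\<^sub>0\<^sup>2\<bar> * sqrt q + 3 * \<bar>\<alpha>\<bar> * (\<bar>\<xi>\<^sub>0\<bar> * q) + \<bar>\<alpha>\<bar> * sqrt q ^ 3) * ((1 + \<bar>w\<bar>) * (1 + \<bar>\<eta>\<bar>) ^ 3)"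
proof -
  let ?y = "(1 + \<bar>w\<bar>) * (1 + \<bar>\<eta>\<bar>) ^ 3"
  let ?A = "sqrt p" and ?B = "\<bar>c - 3 * \<alpha> * \<xi>\<^sub>0\<^sup>2\<bar> * sqrt q" and ?C = "3 * \<bar>\<alpha>\<bar> * (\<bar>\<xi>\<^sub>0\<bar> * q)" and ?D = "\<bar>\<alpha>\<bar> * sqrt q ^ 3"
  have e: "1 \<le> (1 + \<bar>\<eta>\<bar>) ^ 3" by simp
  have pow: "\<bar>\<eta>\<bar> ^ k \<le> (1 + \<bar>\<eta>\<bar>) ^ 3" if "k \<le> 3" for k
  proof -
    have "\<bar>\<eta>\<bar> ^ k \<le> (1 + \<bar>\<eta>\<bar>) ^ k" by (intro power_mono) auto
    also have "\<dots> \<le> (1 + \<bar>\<eta>\<bar>) ^ 3" using that by (intro power_increasing) auto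
    finally show ?thesis .
  qed
  have up: "x \<le> ?y" if "x \<le> (1 + \<bar>\<eta>\<bar>) ^ 3" for x
    using that mult_mono[of 1 "1 + \<bar>w\<bar>" "(1 + \<bar>\<eta>\<bar>) ^ 3" "(1 + \<bar>\<eta>\<bar>) ^ 3"] e by simp
  have w: "\<bar>w\<bar> \<le> ?y"
    using mult_mono[of "\<bar>w\<bar>" "1 + \<bar>w\<bar>" 1 "(1 + \<bar>\<eta>\<bar>) ^ 3"] e by simp
  have "\<bar>modulation \<alpha> \<xi>\<^sub>0 c p q w \<eta>\<bar> \<le> ?A * \<bar>w\<bar> + ?B * \<bar>\<eta>\<bar> ^ 1 + ?C * \<bar>\<eta>\<bar> ^ 2 + ?D * \<bar>\<eta>\<bar> ^ 3"
  proof -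
    have "\<bar>modulation \<alpha> \<xi>\<^sub>0 c p q w \<eta>\<bar> \<le> \<bar>sqrt p * w\<bar> + \<bar>(c - 3 * \<alpha> * \<xi>\<^sub>0\<^sup>2) * sqrt q * \<eta>\<bar>
        + \<bar>3 * \<alpha> * \<xi>\<^sub>0 * q * \<eta>\<^sup>2\<bar> + \<bar>\<alpha> * sqrt q ^ 3 * \<eta> ^ 3\<bar>"
      unfolding modulation_def by linarith
    then show ?thesis
      using assms by (simp add: abs_mult power_abs mult_ac)
  qed
  also have "\<dots> \<le> ?A * ?y + ?B * ?y + ?C * ?y + ?D * ?y"
    using assms by (intro add_mono mult_left_mono up pow w) auto
  finally have "\<bar>modulation \<alpha> \<xi>\<^sub>0 c p q w \<eta>\<bar> \<le> ?A * ?y + ?B * ?y + ?C * ?y + ?D * ?y" .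
  from add_mono[OF up[OF e] this] show ?thesis
    unfolding bracket_def by (simp only: distrib_right mult_1 add.assoc)
qed

lemma bracket_shift: "\<langle>x\<rangle> \<le> \<langle>x + y\<rangle> * \<langle>y\<rangle>"
proof -
  have "\<bar>x\<bar> \<le> \<bar>x + y\<bar> + \<bar>y\<bar>" by linarith
  moreover have "0 \<le> \<bar>x + y\<bar> * \<bar>y\<bar>" by simp
  ultimately show ?thesis
    unfolding bracket_def ring_distribs by linarith
qed

lemma powr_le_power_nat_ceiling:
  fixes x r :: real
  assumes "x \<ge> 1"
  shows "x powr r \<le> x ^ nat \<lceil>r\<rceil>"
proof -
  have "x powr r \<le> x powr real (nat \<lceil>r\<rceil>)"
    using assms by (intro powr_mono real_nat_ceiling_ge) auto
  then show ?thesis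
    using assms by (simp add: powr_realpow)
qed

text \<open>
  A real power of the modulation is at most its next natural power, so that a polynomial
  times the Gaussian dominates the density.
\<close>
lemma packet_density_upper:
  assumes "p > 0" "0 < q" "q \<le> 1"
    and K: "1 + sqrt p + \<bar>c - 3 * \<alpha> * \<xi>\<^sub>0\<^sup>2\<bar> * sqrt q + 3 * \<bar>\<alpha>\<bar> * (\<bar>\<xi>\<^sub>0\<bar> * q) + \<bar>\<alpha>\<bar> * sqrt q ^ 3 \<le> K"
    and M: "\<And>y. (m (\<xi>\<^sub>0 + y) * \<langle>\<xi>\<^sub>0 + y\<rangle> powr s)\<^sup>2 \<le> M * \<langle>y\<rangle>"
  shows "packet_density m \<alpha> s b \<xi>\<^sub>0 c p q z \<le>
     M * K ^ nat \<lceil>2 * b\<rceil> * gaussian_majorant (nat \<lceil>2 * b\<rceil>) (1 + 3 * nat \<lceil>2 * b\<rceil>) z"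
proof (cases z)
  case (Pair w \<eta>)
  let ?n = "nat \<lceil>2 * b\<rceil>" and ?\<xi> = "\<xi>\<^sub>0 + sqrt q * \<eta>" and ?\<sigma> = "modulation \<alpha> \<xi>\<^sub>0 c p q w \<eta>"
  have M0: "M \<ge> 0"
    using M[of 0] order_trans[OF zero_le_power2 M[of 0]] by (simp add: bracket_def)
  have "(m ?\<xi> * \<langle>?\<xi>\<rangle> powr s)\<^sup>2 \<le> M * \<langle>sqrt q * \<eta>\<rangle>" by (rule M)
  also have "\<dots> \<le> M * (1 + \<bar>\<eta>\<bar>)"
  proof -
    have "sqrt q * \<bar>\<eta>\<bar> \<le> 1 * \<bar>\<eta>\<bar>" using assms by (intro mult_right_mono) auto
    then show ?thesis using M0 assms(2) by (intro mult_left_mono) (auto simp: bracket_def abs_mult)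
  qed
  finally have 1: "(m ?\<xi> * \<langle>?\<xi>\<rangle> powr s)\<^sup>2 \<le> M * (1 + \<bar>\<eta>\<bar>)" .
  have "\<langle>?\<sigma>\<rangle> > 0" using bracket_ge_1[of ?\<sigma>] by linarith
  then have "(\<langle>?\<sigma>\<rangle> powr b)\<^sup>2 = \<langle>?\<sigma>\<rangle> powr (2 * b)"
    by (simp add: powr_power mult.commute)
  also have "\<dots> \<le> \<langle>?\<sigma>\<rangle> ^ ?n"
    by (rule powr_le_power_nat_ceiling[OF bracket_ge_1])
  also have "\<dots> \<le> (K * ((1 + \<bar>w\<bar>) * (1 + \<bar>\<eta>\<bar>) ^ 3)) ^ ?n"
  proof (rule power_mono)
    show "\<langle>?\<sigma>\<rangle> \<le> K * ((1 + \<bar>w\<bar>) * (1 + \<bar>\<eta>\<bar>) ^ 3)"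
      using order_trans[OF bracket_modulation_le[OF assms(2,1)] mult_right_mono[OF K]] by simp
  qed (simp add: bracket_def)
  finally have 2: "(\<langle>?\<sigma>\<rangle> powr b)\<^sup>2 \<le> (K * ((1 + \<bar>w\<bar>) * (1 + \<bar>\<eta>\<bar>) ^ 3)) ^ ?n" .
  have "packet_density m \<alpha> s b \<xi>\<^sub>0 c p q z = (m ?\<xi> * \<langle>?\<xi>\<rangle> powr s)\<^sup>2 * (\<langle>?\<sigma>\<rangle> powr b)\<^sup>2 * exp (- w\<^sup>2 - \<eta>\<^sup>2)"
    unfolding packet_density_def Pair prod.case by (simp only: power_mult_distrib)
  also have "\<dots> \<le> M * (1 + \<bar>\<eta>\<bar>) * (K * ((1 + \<bar>w\<bar>) * (1 + \<bar>\<eta>\<bar>) ^ 3)) ^ ?n * exp (- w\<^sup>2 - \<eta>\<^sup>2)"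
    using 1 2 M0 by (intro mult_right_mono mult_mono) auto
  also have "\<dots> = M * K ^ ?n * gaussian_majorant ?n (1 + 3 * ?n) z"
  proof -
    have "exp (- w\<^sup>2 - \<eta>\<^sup>2) = exp (- w\<^sup>2) * exp (- \<eta>\<^sup>2)"
      by (simp add: exp_add[symmetric])
    then show ?thesis
      unfolding gaussian_majorant_def Pair prod.case power_mult_distrib power_add power_mult power_one_right
      by (simp only: mult_ac)
  qed
  finally show ?thesis .
qed

lemma packet_density_nonneg: "packet_density m \<alpha> s b \<xi>\<^sub>0 c p q z \<ge> 0"
  by (simp add: packet_density_def case_prod_unfold)

lemma half_weight_le:
  "(\<langle>\<xi>\<^sub>0 + y\<rangle> powr (-1/2))\<^sup>2 \<le> (1 / \<langle>\<xi>\<^sub>0\<rangle>) * \<langle>y\<rangle>"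
proof -
  have pos: "\<langle>x\<rangle> > 0" for x using bracket_ge_1[of x] by linarith
  have "(\<langle>\<xi>\<^sub>0 + y\<rangle> powr (-1/2))\<^sup>2 = \<langle>\<xi>\<^sub>0 + y\<rangle> powr (-1)"
    using pos[of "\<xi>\<^sub>0 + y"] by (subst powr_power) auto
  also have "\<dots> = 1 / \<langle>\<xi>\<^sub>0 + y\<rangle>"
    using less_imp_le[OF pos[of "\<xi>\<^sub>0 + y"]] by (simp add: powr_minus_divide)
  also have "\<dots> \<le> (1 / \<langle>\<xi>\<^sub>0\<rangle>) * \<langle>y\<rangle>"
    using pos[of "\<xi>\<^sub>0 + y"] pos[of \<xi>\<^sub>0] bracket_shift[of \<xi>\<^sub>0 y] by (simp add: field_simps)
  finally show ?thesis .
qed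

text \<open>
  The constant is uniform in the packet. The assumption on the slope covers two cases: packets tangent to
  the curve, and packets so short that their slope is irrelevant.
\<close>
lemma X_norm_packet_upper:
  fixes \<alpha> b K :: real
  obtains C where "C > 0" 
    "\<And>\<xi>\<^sub>0 c q. \<xi>\<^sub>0 \<noteq> 0 \<Longrightarrow> 0 < q \<Longrightarrow> q \<le> 1 \<Longrightarrow> \<bar>\<xi>\<^sub>0\<bar> * q \<le> 1 \<Longrightarrow> \<bar>c - 3 * \<alpha> * \<xi>\<^sub>0\<^sup>2\<bar> * sqrt q \<le> K \<Longrightarrow>
        (X_norm \<alpha> (-1/2) b (packet (\<alpha> * \<xi>\<^sub>0 ^ 3) \<xi>\<^sub>0 c 1 q))\<^sup>2 \<le> C / (\<bar>\<xi>\<^sub>0\<bar> * sqrt q)"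
proof -
  let ?n = "nat \<lceil>2 * b\<rceil>"
  define L where "L = 2 + \<bar>K\<bar> + 4 * \<bar>\<alpha>\<bar>"
  define J where "J = integral\<^sup>L lborel (gaussian_majorant ?n (1 + 3 * ?n))"
  have J0: "J \<ge> 0" unfolding J_def by (intro Bochner_Integration.integral_nonneg gaussian_majorant_nonneg)
  have L0: "L \<ge> 0" unfolding L_def by simp
  define C where "C = 4 * pi\<^sup>2 * (L ^ ?n * J) + 1"
  have "C > 0" unfolding C_def using J0 L0 by (intro add_nonneg_pos mult_nonneg_nonneg) auto
  moreover have "(X_norm \<alpha> (-1/2) b (packet (\<alpha> * \<xi>\<^sub>0 ^ 3) \<xi>\<^sub>0 c 1 q))\<^sup>2 \<le> C / (\<bar>\<xi>\<^sub>0\<bar> * sqrt q)"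
    if *: "\<xi>\<^sub>0 \<noteq> 0" "0 < q" "q \<le> 1" "\<bar>\<xi>\<^sub>0\<bar> * q \<le> 1" "\<bar>c - 3 * \<alpha> * \<xi>\<^sub>0\<^sup>2\<bar> * sqrt q \<le> K" for \<xi>\<^sub>0 c q
  proof -
    let ?D = "packet_density (\<lambda>_. 1) \<alpha> (-1/2) b \<xi>\<^sub>0 c 1 q"
    have sq: "sqrt q > 0" "sqrt q \<le> 1" using * by auto
    have "3 * \<bar>\<alpha>\<bar> * (\<bar>\<xi>\<^sub>0\<bar> * q) \<le> 3 * \<bar>\<alpha>\<bar> * 1" using * by (intro mult_left_mono) auto
    moreover have "\<bar>\<alpha>\<bar> * sqrt q ^ 3 \<le> \<bar>\<alpha>\<bar> * 1" using sq by (intro mult_left_mono power_le_one) auto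
    ultimately have K: "1 + sqrt 1 + \<bar>c - 3 * \<alpha> * \<xi>\<^sub>0\<^sup>2\<bar> * sqrt q + 3 * \<bar>\<alpha>\<bar> * (\<bar>\<xi>\<^sub>0\<bar> * q) + \<bar>\<alpha>\<bar> * sqrt q ^ 3 \<le> L"
      using *(5) abs_ge_self[of K] unfolding L_def real_sqrt_one by linarith
    have "integral\<^sup>L lborel ?D \<le> (LINT z|lborel. 1 / \<langle>\<xi>\<^sub>0\<rangle> * L ^ ?n * gaussian_majorant ?n (1 + 3 * ?n) z)"
    proof (rule integral_mono')
      show "integrable lborel (\<lambda>z. 1 / \<langle>\<xi>\<^sub>0\<rangle> * L ^ ?n * gaussian_majorant ?n (1 + 3 * ?n) z)"
        by (intro integrable_mult_right integrable_gaussian_majorant)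
      show "?D z \<le> 1 / \<langle>\<xi>\<^sub>0\<rangle> * L ^ ?n * gaussian_majorant ?n (1 + 3 * ?n) z" for z
        by (rule packet_density_upper[OF _ *(2,3) K]) (use half_weight_le in auto)
      then show "0 \<le> 1 / \<langle>\<xi>\<^sub>0\<rangle> * L ^ ?n * gaussian_majorant ?n (1 + 3 * ?n) z" for z
        using order_trans[OF packet_density_nonneg] by blast
    qed
    also have "\<dots> = 1 / \<langle>\<xi>\<^sub>0\<rangle> * (L ^ ?n * J)"
      unfolding J_def by (simp only: integral_mult_right_zero mult.assoc)
    also have "\<dots> \<le> 1 / \<bar>\<xi>\<^sub>0\<bar> * (L ^ ?n * J)"
      using * J0 L0 by (intro mult_right_mono divide_left_mono) (auto simp: bracket_def)
    finally have "4 * pi\<^sup>2 / sqrt q * integral\<^sup>L lborel ?D \<le> 4 * pi\<^sup>2 / sqrt q * (1 / \<bar>\<xi>\<^sub>0\<bar> * (L ^ ?n * J))"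
      using sq by (intro mult_left_mono) auto
    also have "\<dots> \<le> C / (\<bar>\<xi>\<^sub>0\<bar> * sqrt q)"
      using *(1) sq unfolding C_def by (simp add: field_simps)
    finally show ?thesis
      using X_norm_packet_eq[of 1 q "\<lambda>_. 1" "packet (\<alpha> * \<xi>\<^sub>0 ^ 3) \<xi>\<^sub>0 c 1 q" \<alpha> \<xi>\<^sub>0 c "-1/2" b] *(2) by simp
  qed
  ultimately show ?thesis using that by blast
qed

section \<open>Lower bound for the derivative of a resonant packet\<close>

text \<open>
  The exponent \<open>-1 + 8 \<epsilon>\<close> of the modulation may have either sign; this bound treats both
  at once, and is why the modulation is estimated from both sides.
\<close>
lemma powr_ge_min:
  fixes x l u r :: real
  assumes "0 < l" "l \<le> x" "x \<le> u"
  shows "min (l powr r) (u powr r) \<le> x powr r"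
proof (cases "r \<ge> 0")
  case True
  then show ?thesis using assms by (intro min.coboundedI1 powr_mono2) auto
next
  case False
  then show ?thesis using assms by (intro min.coboundedI2 powr_mono2') auto
qed

lemma integral_ge_on_unit_box:
  fixes f :: "real \<times> real \<Rightarrow> real"
  assumes f: "integrable lborel f" "\<And>z. f z \<ge> 0"
    and c: "\<And>w \<eta>. 0 \<le> w \<Longrightarrow> w \<le> 1 \<Longrightarrow> 1 \<le> \<eta> \<Longrightarrow> \<eta> \<le> 2 \<Longrightarrow> c \<le> f (w, \<eta>)"
  shows "c \<le> integral\<^sup>L lborel f"
proof -
  let ?B = "cbox (0::real, 1::real) (1, 2)"
  have "measure lborel ?B = 1"
    by (simp add: content_Pair)
  then have "c = (LINT z|lborel. c * indicator ?B z)"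
    by simp
  also have "\<dots> \<le> integral\<^sup>L lborel f"
  proof (rule integral_mono)
    show "integrable lborel (\<lambda>z. c * indicator ?B z)"
      by (intro integrable_mult_right integrable_real_indicator) (simp_all only: emeasure_lborel_cbox_finite, simp)
    show "c * indicator ?B z \<le> f z" for z
      using f(2)[of z] c[of "fst z" "snd z"] by (cases z) (auto simp: indicator_def cbox_Pair_eq)
  qed (rule f)
  finally show ?thesis .
qed

lemma derivative_weight_le:
  "(\<bar>\<xi>\<^sub>0 + y\<bar> * \<langle>\<xi>\<^sub>0 + y\<rangle> powr (-1/2))\<^sup>2 \<le> \<langle>\<xi>\<^sub>0\<rangle> * \<langle>y\<rangle>"
proof -
  let ?x = "\<xi>\<^sub>0 + y"
  have x: "\<langle>?x\<rangle> > 0" using bracket_ge_1[of ?x] by linarith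
  have "(\<bar>?x\<bar> * \<langle>?x\<rangle> powr (-1/2))\<^sup>2 \<le> (\<langle>?x\<rangle> * \<langle>?x\<rangle> powr (-1/2))\<^sup>2"
    by (intro power_mono mult_right_mono) (auto simp: bracket_def)
  also have "\<dots> = \<langle>?x\<rangle> powr 1"
  proof -
    have "\<langle>?x\<rangle> * \<langle>?x\<rangle> powr (-1/2) = \<langle>?x\<rangle> powr (1/2)"
      using x powr_add[of "\<langle>?x\<rangle>" 1 "-1/2"] by simp
    then show ?thesis using x by (simp only:) (subst powr_power, auto)
  qed
  also have "\<dots> = 1 + \<bar>?x\<bar>" using x by (simp add: bracket_def)
  also have "\<dots> \<le> 1 + \<bar>\<xi>\<^sub>0\<bar> + \<bar>y\<bar> + \<bar>\<xi>\<^sub>0\<bar> * \<bar>y\<bar>"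
    by (simp add: add_increasing2 abs_triangle_ineq)
  also have "\<dots> = \<langle>\<xi>\<^sub>0\<rangle> * \<langle>y\<rangle>"
    by (simp add: bracket_def algebra_simps)
  finally show ?thesis .
qed

text \<open>
  Without integrability the norm would take the default value \<open>0\<close> of the integral, and no lower bound would hold.
\<close>
lemma integrable_derivative_density:
  assumes "p > 0" "0 < q" "q \<le> 1"
  shows "integrable lborel (packet_density abs \<alpha> (-1/2) b \<xi>\<^sub>0 c p q)"
proof -
  define K where "K = 1 + sqrt p + \<bar>c - 3 * \<alpha> * \<xi>\<^sub>0\<^sup>2\<bar> * sqrt q + 3 * \<bar>\<alpha>\<bar> * (\<bar>\<xi>\<^sub>0\<bar> * q) + \<bar>\<alpha>\<bar> * sqrt q ^ 3"
  have le: "packet_density abs \<alpha> (-1/2) b \<xi>\<^sub>0 c p q z \<le>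
     \<langle>\<xi>\<^sub>0\<rangle> * K ^ nat \<lceil>2 * b\<rceil> * gaussian_majorant (nat \<lceil>2 * b\<rceil>) (1 + 3 * nat \<lceil>2 * b\<rceil>) z" for z
    by (rule packet_density_upper[OF assms _ derivative_weight_le]) (simp add: K_def)
  have "integrable lborel (\<lambda>z. \<langle>\<xi>\<^sub>0\<rangle> * K ^ nat \<lceil>2 * b\<rceil> * gaussian_majorant (nat \<lceil>2 * b\<rceil>) (1 + 3 * nat \<lceil>2 * b\<rceil>) z)"
    by (intro integrable_mult_right integrable_gaussian_majorant)
  then show ?thesis
  proof (rule Bochner_Integration.integrable_bound)
    show "packet_density abs \<alpha> (-1/2) b \<xi>\<^sub>0 c p q \<in> borel_measurable lborel"
      using borel_measurable_packet_density[of abs] by simp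
    show "AE z in lborel. norm (packet_density abs \<alpha> (-1/2) b \<xi>\<^sub>0 c p q z) \<le>
        norm (\<langle>\<xi>\<^sub>0\<rangle> * K ^ nat \<lceil>2 * b\<rceil> * gaussian_majorant (nat \<lceil>2 * b\<rceil>) (1 + 3 * nat \<lceil>2 * b\<rceil>) z)"
      using le packet_density_nonneg by (intro AE_I2) (auto intro: order_trans[OF _ abs_ge_self])
  qed
qed

text \<open>
  With \<open>\<theta> = N \<surd>q \<eta>\<close>, which is comparable to \<open>1\<close>, the linear term is \<open>3 (b - a) N \<theta>\<close>. The
  remaining terms are bounded, so the linear term dominates once \<open>N\<close> is large.
\<close>
lemma modulation_transversal:
  fixes a b N q w \<eta> :: real
  assumes N: "N \<ge> 1" "N \<ge> (1 + 112 * \<bar>a\<bar>) / (2 * \<bar>b - a\<bar>)" and "a \<noteq> b"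
    and q: "1 \<le> N * sqrt q" "N * sqrt q \<le> 2" "q > 0"
    and w: "0 \<le> w" "w \<le> 1" and \<eta>: "1 \<le> \<eta>" "\<eta> \<le> 2"
  shows "\<bar>b - a\<bar> * N \<le> \<langle>modulation a N (3 * b * N\<^sup>2) 3 q w \<eta>\<rangle>"
    and "\<langle>modulation a N (3 * b * N\<^sup>2) 3 q w \<eta>\<rangle> \<le> (3 + 12 * \<bar>b - a\<bar> + 112 * \<bar>a\<bar>) * N"
proof -
  let ?\<sigma> = "modulation a N (3 * b * N\<^sup>2) 3 q w \<eta>"
  define \<theta> where "\<theta> = N * sqrt q * \<eta>"
  have \<theta>: "1 \<le> \<theta>" "\<theta> \<le> 4"
    using mult_mono[of 1 "N * sqrt q" 1 \<eta>] mult_mono[of "N * sqrt q" 2 \<eta> 2] q \<eta> by (auto simp: \<theta>_def)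
  have \<sigma>: "?\<sigma> = sqrt 3 * w + 3 * (b - a) * N * \<theta> - (3 * a * \<theta>\<^sup>2 / N + a * \<theta> ^ 3 / N ^ 3)"
  proof -
    have "q = sqrt q * sqrt q" using q by simp
    then have q': "3 * a * N * q * \<eta>\<^sup>2 = 3 * a * N * (sqrt q)\<^sup>2 * \<eta>\<^sup>2" by (simp add: power2_eq_square)
    show ?thesis
      unfolding modulation_def q' \<theta>_def using N(1)
      by (simp add: field_simps power2_eq_square power3_eq_cube)
  qed
  have w': "\<bar>sqrt 3 * w\<bar> \<le> 2"
  proof -
    have "sqrt 3 \<le> 2" by (rule real_le_lsqrt) auto
    then have "sqrt 3 * w \<le> 2 * 1" using w by (intro mult_mono) auto
    then show ?thesis using w by simp
  qed
  \<comment> \<open>\<open>112 = 3 * 4\<^sup>2 + 4\<^sup>3\<close>, from \<open>\<theta> \<le> 4\<close>\<close>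
  have err: "\<bar>3 * a * \<theta>\<^sup>2 / N + a * \<theta> ^ 3 / N ^ 3\<bar> \<le> 112 * \<bar>a\<bar>"
  proof -
    have "\<theta>\<^sup>2 / N \<le> 4\<^sup>2 / 1" "\<theta> ^ 3 / N ^ 3 \<le> 4 ^ 3 / 1"
      using \<theta> N by (intro frac_le power_mono one_le_power; simp)+
    then have "\<bar>a\<bar> * (\<theta>\<^sup>2 / N) \<le> \<bar>a\<bar> * 16" "\<bar>a\<bar> * (\<theta> ^ 3 / N ^ 3) \<le> \<bar>a\<bar> * 64"
      by (intro mult_left_mono; simp)+
    moreover have "\<bar>3 * a * \<theta>\<^sup>2 / N + a * \<theta> ^ 3 / N ^ 3\<bar> \<le> \<bar>3 * a * \<theta>\<^sup>2 / N\<bar> + \<bar>a * \<theta> ^ 3 / N ^ 3\<bar>"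
      by (rule abs_triangle_ineq)
    moreover have "\<bar>3 * a * \<theta>\<^sup>2 / N\<bar> = 3 * (\<bar>a\<bar> * (\<theta>\<^sup>2 / N))" "\<bar>a * \<theta> ^ 3 / N ^ 3\<bar> = \<bar>a\<bar> * (\<theta> ^ 3 / N ^ 3)"
      using \<theta> N by (simp_all add: abs_mult)
    ultimately show ?thesis by linarith
  qed
  have main: "\<bar>3 * (b - a) * N * \<theta>\<bar> = 3 * (\<bar>b - a\<bar> * N * \<theta>)"
    using \<theta> N by (simp add: abs_mult del: right_diff_distrib_numeral)
  have "\<bar>b - a\<bar> * N * 1 \<le> \<bar>b - a\<bar> * N * \<theta>" "\<bar>b - a\<bar> * N * \<theta> \<le> \<bar>b - a\<bar> * N * 4"
    using \<theta> N by (intro mult_left_mono; simp)+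
  moreover have "1 + 112 * \<bar>a\<bar> \<le> 2 * (\<bar>b - a\<bar> * N)"
    using N(2) \<open>a \<noteq> b\<close> by (simp add: field_simps)
  ultimately show "\<bar>b - a\<bar> * N \<le> \<langle>?\<sigma>\<rangle>"
    using w' err main unfolding \<sigma> bracket_def by linarith
  have "1 \<le> N" "\<bar>a\<bar> * 1 \<le> \<bar>a\<bar> * N" using N mult_left_mono[of 1 N "\<bar>a\<bar>"] by auto
  then show "\<langle>?\<sigma>\<rangle> \<le> (3 + 12 * \<bar>b - a\<bar> + 112 * \<bar>a\<bar>) * N"
    using w' err main \<open>\<bar>b - a\<bar> * N * \<theta> \<le> \<bar>b - a\<bar> * N * 4\<close>
    unfolding \<sigma> bracket_def distrib_right by linarith
qed

text \<open>
  On the box \<open>0 \<le> w \<le> 1\<close>, \<open>1 \<le> \<eta> \<le> 2\<close> the weight \<open>\<xi>\<^sup>2 / \<langle>\<xi>\<rangle>\<close> is at least \<open>N/2\<close>, the modulation weight is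
  comparable to \<open>N\<^bsup>2\<beta>\<^esup>\<close> and the Gaussian is at least \<open>e\<^bsup>-5\<^esup>\<close>; a further factor of size \<open>N\<close> is
  the constant \<open>1/\<surd>(pq)\<close> of \<open>X_norm_packet_eq\<close>.
\<close>
lemma X_norm_derivative_lower:
  fixes a b \<beta> :: real
  assumes "a \<noteq> b"
  obtains k N\<^sub>0 where "k > 0" "N\<^sub>0 \<ge> 1"
    "\<And>N q f. N \<ge> N\<^sub>0 \<Longrightarrow> 1 \<le> N * sqrt q \<Longrightarrow> N * sqrt q \<le> 2 \<Longrightarrow> 0 < q \<Longrightarrow> q \<le> 1 \<Longrightarrow>
       (\<And>\<tau> \<xi>. cmod (fourier f (\<tau>, \<xi>)) = \<bar>\<xi>\<bar> * cmod (fourier (packet (a * N ^ 3) N (3 * b * N\<^sup>2) 3 q) (\<tau>, \<xi>))) \<Longrightarrow>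
       k * N\<^sup>2 * N powr (2 * \<beta>) \<le> (X_norm a (-1/2) \<beta> f)\<^sup>2"
proof -
  define l u where "l = \<bar>b - a\<bar>" and "u = 3 + 12 * \<bar>b - a\<bar> + 112 * \<bar>a\<bar>"
  have lu: "l > 0" "u > 0"
    using assms unfolding l_def u_def by (simp, intro add_pos_nonneg mult_nonneg_nonneg) auto
  define \<kappa> where "\<kappa> = min (l powr (2 * \<beta>)) (u powr (2 * \<beta>))"
  have \<kappa>: "\<kappa> > 0" using lu by (simp add: \<kappa>_def)
  define k where "k = 4 * pi\<^sup>2 / 4 * (1 / 2 * exp (- 5) * \<kappa>)"
  define N\<^sub>0 where "N\<^sub>0 = max 1 ((1 + 112 * \<bar>a\<bar>) / (2 * \<bar>b - a\<bar>))"
  have "k > 0" using \<kappa> by (simp add: k_def)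
  moreover have "N\<^sub>0 \<ge> 1" by (simp add: N\<^sub>0_def)
  moreover have "k * N\<^sup>2 * N powr (2 * \<beta>) \<le> (X_norm a (-1/2) \<beta> f)\<^sup>2"
    if N: "N \<ge> N\<^sub>0" and q: "1 \<le> N * sqrt q" "N * sqrt q \<le> 2" "0 < q" "q \<le> 1"
      and f: "\<And>\<tau> \<xi>. cmod (fourier f (\<tau>, \<xi>)) = \<bar>\<xi>\<bar> * cmod (fourier (packet (a * N ^ 3) N (3 * b * N\<^sup>2) 3 q) (\<tau>, \<xi>))"
    for N q f
  proof -
    have N1: "N \<ge> 1" "N \<ge> (1 + 112 * \<bar>a\<bar>) / (2 * \<bar>b - a\<bar>)" using N by (auto simp: N\<^sub>0_def)
    let ?D = "packet_density abs a (-1/2) \<beta> N (3 * b * N\<^sup>2) 3 q"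
    let ?c = "N / 2 * (\<kappa> * N powr (2 * \<beta>)) * exp (- 5)"
    have "?c \<le> ?D (w, \<eta>)" if w: "0 \<le> w" "w \<le> 1" and \<eta>: "1 \<le> \<eta>" "\<eta> \<le> 2" for w \<eta>
    proof -
      let ?\<xi> = "N + sqrt q * \<eta>" and ?\<sigma> = "modulation a N (3 * b * N\<^sup>2) 3 q w \<eta>"
      have \<xi>: "?\<xi> \<ge> N" using q \<eta> by simp
      then have \<xi>1: "?\<xi> \<ge> 1" using N1 by linarith
      have "(\<bar>?\<xi>\<bar> * \<langle>?\<xi>\<rangle> powr (-1/2))\<^sup>2 = ?\<xi>\<^sup>2 / (1 + ?\<xi>)"
      proof -
        have "\<langle>?\<xi>\<rangle> = 1 + ?\<xi>" using \<xi> N1 by (simp add: bracket_def)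
        moreover have "((1 + ?\<xi>) powr (-1/2))\<^sup>2 = (1 + ?\<xi>) powr (-1)"
          using \<xi> N1 by (subst powr_power) auto
        moreover have "\<dots> = 1 / (1 + ?\<xi>)"
          using \<xi> N1 by (subst powr_minus_divide) auto
        ultimately show ?thesis
          by (simp only: power_mult_distrib power2_abs times_divide_eq_right mult_1_right)
      qed
      moreover have "N / 2 \<le> ?\<xi>\<^sup>2 / (1 + ?\<xi>)"
      proof -
        have "N * (1 + ?\<xi>) \<le> ?\<xi> * (?\<xi> + ?\<xi>)" using \<xi> \<xi>1 by (intro mult_mono) linarith+
        moreover have "N / 2 \<le> x\<^sup>2 / (1 + x)" if "N * (1 + x) \<le> x * (x + x)" "x \<ge> 1" for x
          using that by (simp add: field_simps power2_eq_square)
        ultimately show ?thesis using \<xi>1 by blast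
      qed
      ultimately have 1: "N / 2 \<le> (\<bar>?\<xi>\<bar> * \<langle>?\<xi>\<rangle> powr (-1/2))\<^sup>2" by simp
      have "\<langle>?\<sigma>\<rangle> > 0" using bracket_ge_1[of ?\<sigma>] by linarith
      then have "(\<langle>?\<sigma>\<rangle> powr \<beta>)\<^sup>2 = \<langle>?\<sigma>\<rangle> powr (2 * \<beta>)" by (simp add: powr_power mult.commute)
      moreover have "min ((l * N) powr (2 * \<beta>)) ((u * N) powr (2 * \<beta>)) \<le> \<langle>?\<sigma>\<rangle> powr (2 * \<beta>)"
        using modulation_transversal[OF N1 assms q(1-3) w \<eta>] lu N1
        by (intro powr_ge_min) (auto simp: l_def u_def)
      moreover have "min ((l * N) powr (2 * \<beta>)) ((u * N) powr (2 * \<beta>)) = \<kappa> * N powr (2 * \<beta>)"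
        using lu N1 by (simp add: powr_mult \<kappa>_def min_mult_distrib_right)
      ultimately have 2: "\<kappa> * N powr (2 * \<beta>) \<le> (\<langle>?\<sigma>\<rangle> powr \<beta>)\<^sup>2" by simp
      have "w\<^sup>2 \<le> 1\<^sup>2" "\<eta>\<^sup>2 \<le> 2\<^sup>2" using w \<eta> by (intro power_mono; simp)+
      then have 3: "exp (- 5) \<le> exp (- w\<^sup>2 - \<eta>\<^sup>2)" by simp
      have "?c \<le> (\<bar>?\<xi>\<bar> * \<langle>?\<xi>\<rangle> powr (-1/2))\<^sup>2 * (\<langle>?\<sigma>\<rangle> powr \<beta>)\<^sup>2 * exp (- w\<^sup>2 - \<eta>\<^sup>2)"
        using \<kappa> N1 by (intro mult_mono 1 2 3) auto
      also have "\<dots> = ?D (w, \<eta>)"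
        unfolding packet_density_def prod.case by (simp only: power_mult_distrib)
      finally show ?thesis .
    qed
    then have int: "?c \<le> integral\<^sup>L lborel ?D"
      by (intro integral_ge_on_unit_box integrable_derivative_density packet_density_nonneg q) auto
    have "N \<le> 4 / sqrt (3 * q)"
    proof -
      have "sqrt 3 \<le> 2" by (rule real_le_lsqrt) auto
      then have "N * sqrt (3 * q) \<le> 2 * 2"
        using mult_mono[of "sqrt 3" 2 "N * sqrt q" 2] q N1 by (simp add: real_sqrt_mult mult_ac)
      then show ?thesis using q by (simp add: field_simps)
    qed
    from mult_left_mono[OF this, of "4 * pi\<^sup>2 / 4"]
    have "4 * pi\<^sup>2 / 4 * N \<le> 4 * pi\<^sup>2 / sqrt (3 * q)" by (simp add: mult.commute)
    then have "4 * pi\<^sup>2 / 4 * N * ?c \<le> 4 * pi\<^sup>2 / sqrt (3 * q) * integral\<^sup>L lborel ?D"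
      using int \<kappa> N1 q by (intro mult_mono) auto
    also have "\<dots> = (X_norm a (-1/2) \<beta> f)\<^sup>2"
      by (rule X_norm_packet_eq[symmetric]) (use q f in auto)
    finally show ?thesis
      unfolding k_def by (simp add: power2_eq_square mult_ac)
  qed
  ultimately show ?thesis using that by blast
qed

section \<open>Failure of the trilinear estimates\<close>

lemma X_norm_nonneg: "X_norm \<alpha> s b f \<ge> 0"
  unfolding X_norm_def by (intro real_sqrt_ge_zero Bochner_Integration.integral_nonneg) auto

text \<open>
  The packets of the introduction. Squaring the estimate for them
  would give \<open>k N\<^bsup>1+8\<epsilon>\<^esup> \<le> C\<^sup>2 A B\<^sup>2 N\<close>, where \<open>A\<close> and \<open>B\<close> are the constants of the upper bounds and \<open>k\<close>
  that of the lower bound.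
\<close>
lemma trilinear_estimate_fails:
  fixes a b \<epsilon> C :: real
  assumes "a \<noteq> b" "\<epsilon> > 0"
  shows "\<exists>f\<in>schwartz. \<exists>g\<in>schwartz. \<exists>h\<in>schwartz.
    C * (X_norm a (-1/2) (1/2 + \<epsilon>) f * X_norm b (-1/2) (1/2 + \<epsilon>) g * X_norm b (-1/2) (1/2 + \<epsilon>) h)
      < X_norm a (-1/2) (-1/2 + 4 * \<epsilon>) (partial_x (\<lambda>p. f p * g p * h p))"
proof -
  obtain A where A: "A > 0"
    "\<And>\<xi>\<^sub>0 c q. \<xi>\<^sub>0 \<noteq> 0 \<Longrightarrow> 0 < q \<Longrightarrow> q \<le> 1 \<Longrightarrow> \<bar>\<xi>\<^sub>0\<bar> * q \<le> 1 \<Longrightarrow> \<bar>c - 3 * a * \<xi>\<^sub>0\<^sup>2\<bar> * sqrt q \<le> 3 * \<bar>b - a\<bar> \<Longrightarrow>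
        (X_norm a (-1/2) (1/2 + \<epsilon>) (packet (a * \<xi>\<^sub>0 ^ 3) \<xi>\<^sub>0 c 1 q))\<^sup>2 \<le> A / (\<bar>\<xi>\<^sub>0\<bar> * sqrt q)"
    using X_norm_packet_upper[of a "3 * \<bar>b - a\<bar>" "1/2 + \<epsilon>"] by blast
  obtain B where B: "B > 0"
    "\<And>\<xi>\<^sub>0 c q. \<xi>\<^sub>0 \<noteq> 0 \<Longrightarrow> 0 < q \<Longrightarrow> q \<le> 1 \<Longrightarrow> \<bar>\<xi>\<^sub>0\<bar> * q \<le> 1 \<Longrightarrow> \<bar>c - 3 * b * \<xi>\<^sub>0\<^sup>2\<bar> * sqrt q \<le> 0 \<Longrightarrow>
        (X_norm b (-1/2) (1/2 + \<epsilon>) (packet (b * \<xi>\<^sub>0 ^ 3) \<xi>\<^sub>0 c 1 q))\<^sup>2 \<le> B / (\<bar>\<xi>\<^sub>0\<bar> * sqrt q)"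
    using X_norm_packet_upper[of b 0 "1/2 + \<epsilon>"] by blast
  obtain k N\<^sub>0 where k: "k > 0" "N\<^sub>0 \<ge> 1"
    "\<And>N q f. N \<ge> N\<^sub>0 \<Longrightarrow> 1 \<le> N * sqrt q \<Longrightarrow> N * sqrt q \<le> 2 \<Longrightarrow> 0 < q \<Longrightarrow> q \<le> 1 \<Longrightarrow>
       (\<And>\<tau> \<xi>. cmod (fourier f (\<tau>, \<xi>)) = \<bar>\<xi>\<bar> * cmod (fourier (packet (a * N ^ 3) N (3 * b * N\<^sup>2) 3 q) (\<tau>, \<xi>))) \<Longrightarrow>
       k * N\<^sup>2 * N powr (2 * (-1/2 + 4 * \<epsilon>)) \<le> (X_norm a (-1/2) (-1/2 + 4 * \<epsilon>) f)\<^sup>2"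
    using X_norm_derivative_lower[OF assms(1), of "-1/2 + 4 * \<epsilon>"] by blast
  define R where "R = C\<^sup>2 * (A * B * B) / k"
  have R: "R \<ge> 0" using A(1) B(1) k(1) by (simp add: R_def)
  \<comment> \<open>large enough for \<open>N\<^bsup>8\<epsilon>\<^esup>\<close> to exceed \<open>R\<close>, for \<open>q \<le> 1\<close> below and for the lower bound to apply\<close>
  define N where "N = max (max 2 N\<^sub>0) ((R + 1) powr (1 / (8 * \<epsilon>)))"
  have N: "N \<ge> N\<^sub>0" "N \<ge> 2" "N > 0" by (auto simp: N_def)
  have "R < N powr (8 * \<epsilon>)"
  proof -
    have "R + 1 = ((R + 1) powr (1 / (8 * \<epsilon>))) powr (8 * \<epsilon>)"
      using R assms(2) by (simp add: powr_powr)
    also have "\<dots> \<le> N powr (8 * \<epsilon>)"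
      using assms(2) by (intro powr_mono2) (auto simp: N_def)
    finally show ?thesis by simp
  qed
  \<comment> \<open>tangent to the second curve at \<open>N\<close> and at \<open>-N\<close>\<close>
  define c where "c = 3 * b * N\<^sup>2"
  define f where "f = packet (a * N ^ 3) N c 1 (1 / N ^ 4)"
  define g where "g = packet (b * N ^ 3) N c 1 (1 / N\<^sup>2)"
  define h where "h = packet (b * (- N) ^ 3) (- N) c 1 (1 / N\<^sup>2)"
  define q where "q = 1 / N ^ 4 + 1 / N\<^sup>2 + 1 / N\<^sup>2"
  have schw: "f \<in> schwartz" "g \<in> schwartz" "h \<in> schwartz"
    unfolding f_def g_def h_def using N by (auto intro!: packet_in_schwartz)
  have sqrt4: "sqrt (1 / N ^ 4) = 1 / N\<^sup>2"
    using N by (intro real_sqrt_unique) (auto simp: power_divide)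
  have sqrt2: "sqrt (1 / N\<^sup>2) = 1 / N"
    using N by (intro real_sqrt_unique) (auto simp: power_divide)
  have N4: "N \<le> N ^ 4" "N \<le> N\<^sup>2" "1 \<le> N ^ 4" "1 \<le> N\<^sup>2"
    using N self_le_power[of N 4] self_le_power[of N 2] by (auto intro: one_le_power)
  have fn: "(X_norm a (-1/2) (1/2 + \<epsilon>) f)\<^sup>2 \<le> A * N"
  proof -
    have "\<bar>c - 3 * a * N\<^sup>2\<bar> * sqrt (1 / N ^ 4) = 3 * \<bar>b - a\<bar>"
    proof -
      have "c - 3 * a * N\<^sup>2 = 3 * (b - a) * N\<^sup>2" by (simp add: c_def algebra_simps)
      then show ?thesis using N by (simp add: sqrt4 abs_mult del: right_diff_distrib_numeral)
    qed
    then have "(X_norm a (-1/2) (1/2 + \<epsilon>) f)\<^sup>2 \<le> A / (\<bar>N\<bar> * sqrt (1 / N ^ 4))"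
      unfolding f_def using N N4 by (intro A(2)) (auto simp: field_simps)
    also have "\<dots> = A * N" using N by (simp add: sqrt4 power2_eq_square)
    finally show ?thesis .
  qed
  have gn: "(X_norm b (-1/2) (1/2 + \<epsilon>) g)\<^sup>2 \<le> B"
  proof -
    have "(X_norm b (-1/2) (1/2 + \<epsilon>) g)\<^sup>2 \<le> B / (\<bar>N\<bar> * sqrt (1 / N\<^sup>2))"
      unfolding g_def using N N4 by (intro B(2)) (auto simp: field_simps c_def)
    also have "\<dots> = B" using N by (simp add: sqrt2)
    finally show ?thesis .
  qed
  have hn: "(X_norm b (-1/2) (1/2 + \<epsilon>) h)\<^sup>2 \<le> B"
  proof -
    have "(X_norm b (-1/2) (1/2 + \<epsilon>) h)\<^sup>2 \<le> B / (\<bar>- N\<bar> * sqrt (1 / N\<^sup>2))"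
      unfolding h_def using N N4 by (intro B(2)) (auto simp: field_simps c_def)
    also have "\<dots> = B" using N by (simp add: sqrt2)
    finally show ?thesis .
  qed
  have fgh: "(\<lambda>p. f p * g p * h p) = packet (a * N ^ 3) N c 3 q"
    unfolding f_def g_def h_def packet_mult q_def by (simp add: add.assoc)
  have q: "q > 0" "q \<le> 1" "1 \<le> N * sqrt q" "N * sqrt q \<le> 2"
  proof -
    have "4 * 1 \<le> N * N" using mult_mono[of 2 N 2 N] N by simp
    then have N2: "1 / N\<^sup>2 \<le> 1 / 4" using N by (simp add: divide_simps power2_eq_square)
    have N4': "1 / N ^ 4 \<le> 1 / N\<^sup>2"
      using N power_increasing[of 2 4 N] by (intro divide_left_mono) auto
    show "q > 0" using N by (simp add: q_def add_pos_pos)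
    show "q \<le> 1" using N2 N4' unfolding q_def by linarith
    have "0 \<le> 1 / N ^ 4" "0 \<le> 1 / N\<^sup>2" using N by auto
    then have "sqrt (1 / N\<^sup>2) \<le> sqrt q" unfolding q_def by (intro real_sqrt_le_mono) linarith
    then show "1 \<le> N * sqrt q" using N by (simp add: sqrt2 field_simps)
    have "q \<le> 4 * (1 / N\<^sup>2)" using N4' \<open>0 \<le> 1 / N\<^sup>2\<close> unfolding q_def by linarith
    then have "sqrt q \<le> sqrt (4 * (1 / N\<^sup>2))" by (rule real_sqrt_le_mono)
    also have "\<dots> = 2 / N" by (subst real_sqrt_mult, subst sqrt2) simp
    finally show "N * sqrt q \<le> 2" using N by (simp add: field_simps)
  qed
  let ?L = "X_norm a (-1/2) (-1/2 + 4 * \<epsilon>) (partial_x (\<lambda>p. f p * g p * h p))"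
  have L: "k * N\<^sup>2 * N powr (2 * (-1/2 + 4 * \<epsilon>)) \<le> ?L\<^sup>2"
    unfolding fgh c_def
    by (rule k(3)) (use N q packet_in_schwartz in \<open>auto simp: fourier_partial_x norm_mult\<close>)
  let ?Q = "X_norm a (-1/2) (1/2 + \<epsilon>) f * X_norm b (-1/2) (1/2 + \<epsilon>) g * X_norm b (-1/2) (1/2 + \<epsilon>) h"
  have "?Q\<^sup>2 \<le> A * N * B * B"
    unfolding power_mult_distrib using fn gn hn A(1) B(1) N by (intro mult_mono) auto
  then have "(C * ?Q)\<^sup>2 \<le> C\<^sup>2 * (A * N * B * B)"
    unfolding power_mult_distrib[of C] by (intro mult_left_mono) auto
  also have "\<dots> = k * N * R" using k(1) by (simp add: R_def)
  also have "\<dots> < k * N * N powr (8 * \<epsilon>)"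
    using k(1) N \<open>R < N powr (8 * \<epsilon>)\<close> by (intro mult_strict_left_mono) auto
  also have "\<dots> = k * N\<^sup>2 * N powr (2 * (-1/2 + 4 * \<epsilon>))"
  proof -
    have "N powr (2 * (-1/2 + 4 * \<epsilon>)) = N powr (8 * \<epsilon>) / N"
      using N powr_diff[of N "8 * \<epsilon>" 1] by (simp add: algebra_simps)
    then show ?thesis using N by (simp add: power2_eq_square)
  qed
  also note L
  finally have "(C * ?Q)\<^sup>2 < ?L\<^sup>2" .
  then have "C * ?Q < ?L"
    by (rule power2_less_imp_less) (rule X_norm_nonneg)
  then show ?thesis using schw by blast
qed

theorem proposition1p8:
  fixes \<alpha> \<epsilon> :: real
  assumes "\<alpha> \<noteq> 0" and "\<alpha> \<noteq> 1" and "\<epsilon> > 0"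
  shows "\<not> (\<exists>C>0. \<forall>v\<in>schwartz. \<forall>w\<^sub>1\<in>schwartz. \<forall>w\<^sub>2\<in>schwartz.
            X_norm 1 (-1/2) (-1/2 + 4 * \<epsilon>) (partial_x (\<lambda>p. v p * w\<^sub>1 p * w\<^sub>2 p))
              \<le> C * (X_norm 1 (-1/2) (1/2 + \<epsilon>) v * X_norm \<alpha> (-1/2) (1/2 + \<epsilon>) w\<^sub>1
                    * X_norm \<alpha> (-1/2) (1/2 + \<epsilon>) w\<^sub>2))
       \<and> \<not> (\<exists>C>0. \<forall>v\<^sub>1\<in>schwartz. \<forall>v\<^sub>2\<in>schwartz. \<forall>w\<in>schwartz.
            X_norm \<alpha> (-1/2) (-1/2 + 4 * \<epsilon>) (partial_x (\<lambda>p. v\<^sub>1 p * v\<^sub>2 p * w p))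
              \<le> C * (X_norm 1 (-1/2) (1/2 + \<epsilon>) v\<^sub>1 * X_norm 1 (-1/2) (1/2 + \<epsilon>) v\<^sub>2
                    * X_norm \<alpha> (-1/2) (1/2 + \<epsilon>) w))"
proof (rule conjI; rule notI; elim exE conjE)
  fix C :: real
  assume le: "\<forall>v\<in>schwartz. \<forall>w\<^sub>1\<in>schwartz. \<forall>w\<^sub>2\<in>schwartz.
            X_norm 1 (-1/2) (-1/2 + 4 * \<epsilon>) (partial_x (\<lambda>p. v p * w\<^sub>1 p * w\<^sub>2 p))
              \<le> C * (X_norm 1 (-1/2) (1/2 + \<epsilon>) v * X_norm \<alpha> (-1/2) (1/2 + \<epsilon>) w\<^sub>1
                    * X_norm \<alpha> (-1/2) (1/2 + \<epsilon>) w\<^sub>2)"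
  show False
    using trilinear_estimate_fails[OF assms(2)[symmetric] assms(3), of C] le
    by (blast dest: leD)
next
  fix C :: real
  assume le: "\<forall>v\<^sub>1\<in>schwartz. \<forall>v\<^sub>2\<in>schwartz. \<forall>w\<in>schwartz.
            X_norm \<alpha> (-1/2) (-1/2 + 4 * \<epsilon>) (partial_x (\<lambda>p. v\<^sub>1 p * v\<^sub>2 p * w p))
              \<le> C * (X_norm 1 (-1/2) (1/2 + \<epsilon>) v\<^sub>1 * X_norm 1 (-1/2) (1/2 + \<epsilon>) v\<^sub>2
                    * X_norm \<alpha> (-1/2) (1/2 + \<epsilon>) w)"
  obtain w v\<^sub>1 v\<^sub>2 where "w \<in> schwartz" "v\<^sub>1 \<in> schwartz" "v\<^sub>2 \<in> schwartz" and
    gt: "C * (X_norm \<alpha> (-1/2) (1/2 + \<epsilon>) w * X_norm 1 (-1/2) (1/2 + \<epsilon>) v\<^sub>1 * X_norm 1 (-1/2) (1/2 + \<epsilon>) v\<^sub>2)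
      < X_norm \<alpha> (-1/2) (-1/2 + 4 * \<epsilon>) (partial_x (\<lambda>p. w p * v\<^sub>1 p * v\<^sub>2 p))"
    using trilinear_estimate_fails[OF assms(2,3), of C] by blast
  moreover have "(\<lambda>p. w p * v\<^sub>1 p * v\<^sub>2 p) = (\<lambda>p. v\<^sub>1 p * v\<^sub>2 p * w p)"
    by (simp add: mult_ac)
  ultimately show False
    using le by (fastforce simp: mult_ac)
qed

end
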